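(* Let $0<|q|<1$. Then $$\vartheta_3(0,-q)^{16}=1-\tfrac{32}{3}\left(U_1+U_3+U_5\right)+\tfrac{256}{3}\left(U_1U_5-U_3^2\right),$$ where $$U_s\equiv U_s(q):=\sum_{r=1}^{\infty}(-1)^{r-1}\frac{r^sq^r}{1+q^r}=\sum_{n=1}^{\infty}\Bigl[\sum_{d\mid n,\,d>0}(-1)^{d+n/d}d^s\Bigr]q^n=\sum_{y_1,m_1\ge 1}(-1)^{y_1+m_1}m_1^sq^{m_1y_1},$$ and $$\vartheta_3(0,-q)^{24}=1+\tfrac{16}{9}\left(17G_3+8G_5+2G_7\right)+\tfrac{512}{9}\left(G_3G_7-G_5^2\right),$$ where $$G_s\equiv G_s(q):=\sum_{r=1}^{\infty}(-1)^{r}\frac{r^sq^r}{1-q^r}=\sum_{n=1}^{\infty}\Bigl[\sum_{d\mid n,\,d>0}(-1)^{d}d^s\Bigr]q^n=\sum_{y_1,m_1\ge 1}(-1)^{m_1}m_1^sq^{m_1y_1}.$$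
   Context: $\vartheta_3(0,q):=\sum_{j=-\infty}^{\infty}q^{j^2}$, so $\vartheta_3(0,-q)=\sum_{j=-\infty}^{\infty}(-1)^{j}q^{j^2}$. *)

theory Defs
  imports "HOL-Analysis.Analysis"
begin

text \<open>Jacobi's \<open>\<vartheta>\<^sub>3(z, q)\<close> at \<open>z = 0\<close>. Only nonnegative exponents occur; the integer power
  merely avoids converting the integer \<open>j\<^sup>2\<close> to a natural number.\<close>

definition theta3_null :: "complex \<Rightarrow> complex" where
  "theta3_null q = (\<Sum>\<^sub>\<infinity>j\<in>(UNIV :: int set). q powi (j ^ 2))"

definition U :: "nat \<Rightarrow> complex \<Rightarrow> complex" where
  "U s q = (\<Sum>\<^sub>\<infinity>r\<in>{1::nat..}. (-1) ^ (r - 1) * (of_nat r ^ s * q ^ r / (1 + q ^ r)))"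

definition G :: "nat \<Rightarrow> complex \<Rightarrow> complex" where
  "G s q = (\<Sum>\<^sub>\<infinity>r\<in>{1::nat..}. (-1) ^ r * (of_nat r ^ s * q ^ r / (1 - q ^ r)))"

end

theory Submission
  imports Defs "HOL-Computational_Algebra.Polynomial"
begin

text \<open>The Lambert series are Taylor coefficients, with respect to \<open>log x\<close> at \<open>x = -1\<close>, of
  \<open>f(x) = \<Sum> x\<^sup>n / (1 + q\<^sup>n)\<close> and \<open>h(x) = \<Sum> n x\<^sup>n / (1 - q\<^sup>n)\<close>, the sums being over all integers.
  The partial fraction
  \<open>1 / ((1 + a) (1 + b)) = (1 / (1 + a) + 1 / (1 + b) - 1) / (1 - a b)\<close> and its variant for
  \<open>1 / ((1 - a) (1 + b))\<close> evaluate the convolutions of the coefficients, giving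
  \<open>f\<^sup>2 = c + h\<close> and \<open>h f = K f + f'' / 2\<close>, where \<open>'\<close> is \<open>x d/dx\<close>. Hence \<open>f'' = 2 f\<^sup>3 + L f\<close>. As \<open>f\<close>
  vanishes at \<open>-1\<close>, comparing Taylor coefficients there expresses the two determinants of Lambert
  series through \<open>f'(-1) = - (1 - 8 U\<^sub>1) / 4\<close> alone.

  It remains to see \<open>1 - 8 U\<^sub>1 = \<vartheta>\<^sub>3(0, -q)\<^sup>4\<close>. Let \<open>\<Theta>(x) = \<Sum> (-1)\<^sup>n q\<^bsup>n(n-1)/2\<^esup> x\<^sup>n\<close>. The coefficients
  of \<open>f(x) \<Theta>(x)\<close> satisfy the recurrence of those of \<open>\<Theta>(-x)\<close>, so \<open>f(x) \<Theta>(x) = c \<Theta>(-x)\<close>, and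
  \<open>f'(-1) = - (\<Theta>'(1) / \<Theta>(-1))\<^sup>2\<close>. Finally \<open>2 \<Theta>'(1) = - \<Theta>(-1) \<vartheta>\<^sub>3(0, -q)\<^sup>2\<close>, because the quotient of
  the two sides is unchanged under \<open>q \<mapsto> q\<^sup>2\<close>.\<close>

section \<open>Two-sided series\<close>

lemma summable_on_complex_comparison:
  fixes f :: "'a \<Rightarrow> complex"
  assumes "g summable_on A" and "\<And>x. x \<in> A \<Longrightarrow> norm (f x) \<le> g x"
  shows "f summable_on A"
proof -
  have "(\<lambda>x. norm (f x)) summable_on A"
    by (rule summable_on_comparison_test[OF assms(1)]) (use assms(2) in auto)
  then show ?thesis using summable_on_iff_abs_summable_on_complex by blast
qed

text \<open>The products of norms are summed row by row, which gives absolute convergence on the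
  product set; only then is the double sum evaluated as an iterated one.\<close>

lemma has_sum_product_complex:
  fixes f :: "'a \<Rightarrow> complex" and g :: "'b \<Rightarrow> complex"
  assumes f: "f summable_on A" and g: "g summable_on B"
  shows "((\<lambda>(x, y). f x * g y) has_sum (infsum f A * infsum g B)) (A \<times> B)"
proof -
  have nf: "(\<lambda>x. norm (f x)) summable_on A" and ng: "(\<lambda>x. norm (g x)) summable_on B"
    using f g summable_on_iff_abs_summable_on_complex by blast+
  have "(\<lambda>p. norm (f (fst p)) * norm (g (snd p))) summable_on (A \<times> B)"
  proof (rule summable_on_SigmaI)
    fix x assume "x \<in> A"
    show "((\<lambda>y. norm (f (fst (x, y))) * norm (g (snd (x, y)))) has_sum
        (norm (f x) * (\<Sum>\<^sub>\<infinity>y\<in>B. norm (g y)))) B"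
      unfolding fst_conv snd_conv by (intro has_sum_cmult_right has_sum_infsum ng)
  qed (auto intro: summable_on_cmult_left nf)
  then have "(\<lambda>p. f (fst p) * g (snd p)) summable_on (A \<times> B)"
    by (rule summable_on_complex_comparison) (simp add: norm_mult)
  then have s: "(\<lambda>(x, y). f x * g y) summable_on (A \<times> B)"
    by (simp add: case_prod_unfold)
  show ?thesis
  proof (rule has_sum_SigmaI[OF _ _ s])
    show "((\<lambda>y. case (x, y) of (x, y) \<Rightarrow> f x * g y) has_sum (f x * infsum g B)) B" for x
      using g by (simp add: has_sum_cmult_right)
    show "((\<lambda>x. f x * infsum g B) has_sum (infsum f A * infsum g B)) A"
      using f by (simp add: has_sum_cmult_left)
  qed
qed

text \<open>Reindexing the product sum by \<open>(k, n - k)\<close> collects the pairs with index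
  sum \<open>n\<close>. Applied to terms \<open>a n * x powi n\<close>, this is the Cauchy product
  of two-sided series.\<close>

lemma int_convolution:
  fixes a b :: "int \<Rightarrow> complex"
  assumes a: "a summable_on UNIV" and b: "b summable_on UNIV"
  shows "(\<lambda>k. a k * b (n - k)) summable_on UNIV"
    and "((\<lambda>n. \<Sum>\<^sub>\<infinity>k. a k * b (n - k)) has_sum (infsum a UNIV * infsum b UNIV)) UNIV"
proof -
  have "((\<lambda>(x, y). a x * b y) has_sum (infsum a UNIV * infsum b UNIV)) (UNIV \<times> UNIV)"
    by (rule has_sum_product_complex[OF a b])
  also have "?this \<longleftrightarrow> ((\<lambda>(n, k). a k * b (n - k)) has_sum (infsum a UNIV * infsum b UNIV)) (UNIV \<times> UNIV)"
    by (rule has_sum_reindex_bij_witness[where i = "\<lambda>(n, k). (k, n - k)" and j = "\<lambda>(x, y). (x + y, x)"]) auto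
  finally have hs: "((\<lambda>(n, k). a k * b (n - k)) has_sum (infsum a UNIV * infsum b UNIV)) (UNIV \<times> UNIV)" .
  then have s: "(\<lambda>(n, k). a k * b (n - k)) summable_on (UNIV \<times> UNIV)"
    by (rule has_sum_imp_summable)
  show s1: "(\<lambda>k. a k * b (n - k)) summable_on UNIV" for n
    using summable_on_SigmaD1[OF s, of n] by simp
  show "((\<lambda>n. \<Sum>\<^sub>\<infinity>k. a k * b (n - k)) has_sum (infsum a UNIV * infsum b UNIV)) UNIV"
    by (rule has_sum_SigmaD[OF hs]) (simp add: has_sum_infsum s1)
qed

lemma int_halves: "(UNIV :: int set) = range int \<union> (\<lambda>m. - int m) ` {1..}"
  "range int \<inter> (\<lambda>m. - int m) ` {1..} = {}"
proof -
  have "n \<in> range int \<union> (\<lambda>m. - int m) ` {1..}" for n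
  proof (cases "n \<ge> 0")
    case True
    then have "n = int (nat n)" by simp
    then show ?thesis by blast
  next
    case False
    then have "n = - int (nat (- n))" "nat (- n) \<in> {1..}" by auto
    then show ?thesis by blast
  qed
  then show "(UNIV :: int set) = range int \<union> (\<lambda>m. - int m) ` {1..}" by blast
qed auto

lemma infsum_int_split:
  fixes f :: "int \<Rightarrow> complex"
  assumes "f summable_on UNIV"
  shows "(\<lambda>m. f (int m)) summable_on UNIV" and "(\<lambda>m. f (- int m)) summable_on {1..}"
    and "infsum f UNIV = (\<Sum>\<^sub>\<infinity>m. f (int m)) + (\<Sum>\<^sub>\<infinity>m\<in>{1..}. f (- int m))"
proof -
  have s1: "f summable_on range int" and s2: "f summable_on (\<lambda>m. - int m) ` {1..}"
    using assms by (auto intro: summable_on_subset)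
  have i: "inj_on (\<lambda>m. - int m) {1..}" by (auto simp: inj_on_def)
  show "(\<lambda>m. f (int m)) summable_on UNIV" 
    using s1 summable_on_reindex[of int UNIV f] by (simp add: o_def)
  show "(\<lambda>m. f (- int m)) summable_on {1..}"
    using s2 summable_on_reindex[OF i, of f] by (simp add: o_def)
  have "infsum f UNIV = infsum f (range int) + infsum f ((\<lambda>m. - int m) ` {1..})"
    using infsum_Un_disjoint[OF s1 s2 int_halves(2)] int_halves(1) by simp
  then show "infsum f UNIV = (\<Sum>\<^sub>\<infinity>m. f (int m)) + (\<Sum>\<^sub>\<infinity>m\<in>{1..}. f (- int m))"
    using infsum_reindex[of int UNIV f] infsum_reindex[OF i, of f] by (simp add: o_def)
qed

lemma summable_on_intI:
  fixes f :: "int \<Rightarrow> complex"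
  assumes "(\<lambda>m. f (int m)) summable_on UNIV" and "(\<lambda>m. f (- int m)) summable_on {1..}"
  shows "f summable_on UNIV"
proof -
  have i: "inj_on (\<lambda>m. - int m) {1..}" by (auto simp: inj_on_def)
  have "f summable_on range int" "f summable_on (\<lambda>m. - int m) ` {1..}"
    using assms summable_on_reindex[of int UNIV f] summable_on_reindex[OF i, of f] by (simp_all add: o_def)
  from summable_on_Un_disjoint[OF this int_halves(2)] show ?thesis
    using int_halves(1) by simp
qed

text \<open>Pairing \<open>m\<close> with \<open>- m\<close> turns a two-sided series with symmetric
  coefficients into a Lambert series over positive indices.\<close>

lemma infsum_int_pairs:
  fixes f :: "int \<Rightarrow> complex"
  assumes "f summable_on UNIV"
  shows "infsum f UNIV = f 0 + (\<Sum>\<^sub>\<infinity>m\<in>{1..}. f (int m) + f (- int m))"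
proof -
  note s = infsum_int_split[OF assms]
  have s1: "(\<lambda>m. f (int m)) summable_on {1..}"
    using s(1) by (rule summable_on_subset) auto
  have "(\<Sum>\<^sub>\<infinity>m. f (int m)) = (\<Sum>\<^sub>\<infinity>m\<in>insert 0 {1..}. f (int m))"
    by (rule infsum_cong_neutral) (auto simp: Suc_le_eq)
  also have "\<dots> = f 0 + (\<Sum>\<^sub>\<infinity>m\<in>{1..}. f (int m))"
    by (subst infsum_insert) (use s1 in auto)
  finally show ?thesis
    using s(3) infsum_add[OF s1 s(2)] by simp
qed

lemma infsum_int_reflect:
  fixes f :: "int \<Rightarrow> complex"
  shows "(\<Sum>\<^sub>\<infinity>k. f (c - k)) = (\<Sum>\<^sub>\<infinity>k. f k)" "(\<lambda>k. f (c - k)) summable_on UNIV \<longleftrightarrow> f summable_on UNIV"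
  by (rule infsum_reindex_bij_witness[where i = "\<lambda>k. c - k" and j = "\<lambda>k. c - k"]; simp)
     (rule summable_on_reindex_bij_witness[where i = "\<lambda>k. c - k" and j = "\<lambda>k. c - k"]; simp)

lemma has_sum_int_shift:
  fixes f :: "int \<Rightarrow> complex"
  shows "((\<lambda>k. f (k + c)) has_sum S) UNIV \<longleftrightarrow> (f has_sum S) UNIV"
  by (rule has_sum_reindex_bij_witness[where i = "\<lambda>k. k - c" and j = "\<lambda>k. k + c"]; simp)

section \<open>Laurent series on annuli around the unit circle\<close>

definition laurent_sum :: "(int \<Rightarrow> complex) \<Rightarrow> complex \<Rightarrow> complex" where
  "laurent_sum a x = (\<Sum>\<^sub>\<infinity>n. a n * x powi n)"

text \<open>The annulus is invariant under \<open>x \<mapsto> 1 / x\<close> and, for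
  \<open>0 < R < 1\<close>, contains the unit circle, where the series are finally
  evaluated.\<close>

definition annular :: "real \<Rightarrow> (int \<Rightarrow> complex) \<Rightarrow> bool" where
  "annular R a \<longleftrightarrow> (\<forall>x. R < norm x \<and> norm x < 1 / R \<longrightarrow> (\<lambda>n. a n * x powi n) summable_on UNIV)"

lemma annularD:
  "annular R a \<Longrightarrow> R < norm x \<Longrightarrow> norm x < 1 / R \<Longrightarrow> (\<lambda>n. a n * x powi n) summable_on UNIV"
  by (simp add: annular_def)

lemma nat_times_power_bounded:
  fixes y :: real
  assumes "0 \<le> y" "y < 1"
  shows "\<exists>M. \<forall>n. real n * y ^ n \<le> M"
proof -
  have "(\<lambda>n. real n * y ^ n) \<longlonglongrightarrow> 0"
    using powser_times_n_limit_0[of y] assms by simp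
  then have "Bseq (\<lambda>n. real n * y ^ n)"
    using convergent_imp_Bseq convergentI by blast
  then obtain M where "\<And>n. norm (real n * y ^ n) \<le> M"
    by (auto simp: Bseq_def)
  then have "real n * y ^ n \<le> M" for n by (metis abs_le_D1 real_norm_def)
  then show ?thesis by blast
qed

text \<open>With radii \<open>s < norm x < t\<close> still inside the annulus, the factor
  \<open>n\<close> is absorbed by the geometric gain \<open>norm x / t\<close> per step for
  nonnegative indices and \<open>s / norm x\<close> per step for negative ones.\<close>

lemma annular_times_index:
  assumes R: "0 < R" and a: "annular R a"
  shows "annular R (\<lambda>n. of_int n * a n)"
  unfolding annular_def
proof (intro allI impI)
  fix x :: complex
  assume x: "R < norm x \<and> norm x < 1 / R"
  obtain s where s: "R < s" "s < norm x" using x dense by blast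
  obtain t where t: "norm x < t" "t < 1 / R" using x dense by blast
  have pos: "0 < s" "0 < t" "0 < norm x" using R s t by linarith+
  have st: "s < 1 / R" "R < t" using x s t by linarith+
  \<comment> \<open>A single ratio below 1 that dominates the gain in both directions, so that one
    bound \<open>M\<close> serves all indices.\<close>
  define y where "y = max (norm x / t) (s / norm x)"
  have y: "0 \<le> y" "y < 1" "norm x / t \<le> y" "s / norm x \<le> y"
    using s t pos by (auto simp: y_def le_max_iff_disj)
  obtain M where M: "\<And>n :: nat. real n * y ^ n \<le> M"
    using nat_times_power_bounded[OF y(1,2)] by blast
  have sum: "(\<lambda>n. norm (a n * complex_of_real s powi n)) summable_on UNIV"
    "(\<lambda>n. norm (a n * complex_of_real t powi n)) summable_on UNIV"
    by (intro iffD1[OF summable_on_iff_abs_summable_on_complex] annularD[OF a]; use s t pos st in simp)+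
  show "(\<lambda>n. of_int n * a n * x powi n) summable_on UNIV"
  proof (rule summable_on_complex_comparison)
    show "(\<lambda>n. M * (norm (a n * complex_of_real s powi n) + norm (a n * complex_of_real t powi n))) summable_on UNIV"
      by (intro summable_on_cmult_right summable_on_add sum)
    fix n :: int
    have M0: "M \<ge> 0" using M[of 0] by simp
    consider m where "n = int m" | m where "n = - int m" by (metis int_cases2)
    then show "norm (of_int n * a n * x powi n) \<le>
       M * (norm (a n * complex_of_real s powi n) + norm (a n * complex_of_real t powi n))"
    proof cases
      case 1
      have "norm (of_int n * a n * x powi n) = norm (a n) * t ^ m * (real m * (norm x / t) ^ m)"
        using pos by (simp add: 1 norm_mult norm_power power_divide)
      also have "\<dots> \<le> norm (a n) * t ^ m * (real m * y ^ m)"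
        using pos y by (intro mult_left_mono power_mono) auto
      also have "\<dots> \<le> norm (a n) * t ^ m * M"
        using pos M by (intro mult_left_mono) auto
      also have "\<dots> = M * norm (a n * complex_of_real t powi n)"
        using pos by (simp add: 1 norm_mult norm_power)
      finally show ?thesis using M0 by (simp add: distrib_left add_increasing)
    next
      case 2
      have "norm (of_int n * a n * x powi n) = norm (a n) * (1 / s ^ m) * (real m * (s / norm x) ^ m)"
        using pos by (simp add: 2 norm_mult norm_power norm_divide power_divide power_int_minus norm_inverse field_simps)
      also have "\<dots> \<le> norm (a n) * (1 / s ^ m) * (real m * y ^ m)"
        using pos y by (intro mult_left_mono power_mono) auto
      also have "\<dots> \<le> norm (a n) * (1 / s ^ m) * M"
        using pos M by (intro mult_left_mono) auto
      also have "\<dots> = M * norm (a n * complex_of_real s powi n)"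
        using pos by (simp add: 2 norm_mult norm_power norm_divide power_int_minus norm_inverse field_simps)
      finally show ?thesis using M0 by (simp add: distrib_left add_increasing2)
    qed
  qed
qed

lemma annular_times_index_power:
  assumes "0 < R" and "annular R a"
  shows "annular R (\<lambda>n. of_int n ^ k * a n)"
  by (induction k) (use assms annular_times_index[OF assms(1)] in \<open>simp_all add: mult.assoc\<close>)

text \<open>The operator x d/dx multiplies the n-th coefficient by \<open>n\<close>; dividing by
  \<open>x\<close> recovers the ordinary derivative. Derivatives below are recorded in this
  form.\<close>

lemma power_series_log_derivative:
  fixes c :: "nat \<Rightarrow> complex"
  assumes sum: "\<And>z. norm z < K \<Longrightarrow> summable (\<lambda>n. c n * z ^ n)" and x: "norm x < K" "x \<noteq> 0"
  shows "((\<lambda>z. \<Sum>n. c n * z ^ n) has_field_derivative (\<Sum>n. of_nat n * c n * x ^ n) / x) (at x)"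
proof -
  have d: "((\<lambda>z. \<Sum>n. c n * z ^ n) has_field_derivative (\<Sum>n. diffs c n * x ^ n)) (at x)"
    by (rule termdiffs_strong'[OF sum x(1)])
  have "summable (\<lambda>n. diffs c n * x ^ n)"
    by (rule termdiff_converges[OF x(1)]) (use sum in auto)
  then have "(\<lambda>n. x * (diffs c n * x ^ n)) sums (x * (\<Sum>n. diffs c n * x ^ n))"
    by (intro sums_mult summable_sums)
  then have "(\<lambda>n. of_nat (Suc n) * c (Suc n) * x ^ Suc n) sums (x * (\<Sum>n. diffs c n * x ^ n))"
    by (simp add: diffs_def mult_ac)
  then have "(\<lambda>n. of_nat n * c n * x ^ n) sums (x * (\<Sum>n. diffs c n * x ^ n))"
    by (subst (asm) sums_Suc_iff) simp
  then have "(\<Sum>n. of_nat n * c n * x ^ n) = x * (\<Sum>n. diffs c n * x ^ n)"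
    by (rule sums_unique[symmetric])
  then show ?thesis using d x by simp
qed

lemma summable_on_UNIV_nat_suminf:
  fixes f :: "nat \<Rightarrow> complex"
  assumes "f summable_on UNIV"
  shows "summable f" "infsum f UNIV = suminf f"
  using assms has_sum_imp_sums[OF has_sum_infsum[OF assms]] sums_summable sums_unique by auto

lemma annular_reflect:
  assumes R: "0 < R" and a: "annular R a"
  shows "annular R (\<lambda>n. a (- n))"
  unfolding annular_def
proof (intro allI impI)
  fix x :: complex
  assume x: "R < norm x \<and> norm x < 1 / R"
  have x0: "x \<noteq> 0" using x R by auto
  have "(\<lambda>n. a n * (1 / x) powi n) summable_on UNIV"
    by (rule annularD[OF a])
       (use x R x0 in \<open>simp_all add: norm_divide divide_simps mult.commute\<close>)
  then have "(\<lambda>n. a (- n) * (1 / x) powi (- n)) summable_on UNIV"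
    using infsum_int_reflect(2)[of "\<lambda>n. a n * (1 / x) powi n" 0] by simp
  moreover have "(1 / x) powi (- n) = x powi n" for n
    by (simp add: power_int_minus power_int_one_over)
  ultimately show "(\<lambda>n. a (- n) * x powi n) summable_on UNIV" by simp
qed

lemma annular_powser:
  assumes R: "0 < R" "R < 1" and a: "annular R a" and z: "norm z < 1 / R"
  shows "summable (\<lambda>n. a (int n) * z ^ n)"
proof -
  have "max 1 (norm z) < 1 / R" using R z by simp
  then obtain t where t: "1 < t" "norm z < t" "t < 1 / R" using dense[of "max 1 (norm z)" "1 / R"] by auto
  have "(\<lambda>n. a n * complex_of_real t powi n) summable_on UNIV"
    by (rule annularD[OF a]) (use t R in auto)
  from infsum_int_split(1)[OF this] have "summable (\<lambda>n. a (int n) * complex_of_real t ^ n)"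
    using summable_on_imp_summable by auto
  then show ?thesis
    by (rule powser_inside) (use t in auto)
qed

text \<open>The two halves become ordinary power series in \<open>x\<close> and in
  \<open>1 / x\<close>, with the constant term given to the first, so that termwise differentiation
  of power series applies.\<close>

lemma laurent_sum_conv_powser:
  assumes R: "0 < R" "R < 1" and a: "annular R a" and x: "R < norm x" "norm x < 1 / R"
  shows "laurent_sum a x = (\<Sum>n. a (int n) * x ^ n) + (\<Sum>n. (if n = 0 then 0 else a (- int n)) * (1 / x) ^ n)"
proof -
  note s = infsum_int_split[OF annularD[OF a x]]
  have p: "x powi (- int m) = (1 / x) ^ m" for m
    by (simp add: power_int_minus power_divide divide_inverse power_inverse)
  have "(\<lambda>m. a (- int m) * x powi (- int m)) summable_on {1..} \<longleftrightarrow>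
      (\<lambda>n. (if n = 0 then 0 else a (- int n)) * (1 / x) ^ n) summable_on UNIV"
    by (rule summable_on_cong_neutral) (auto simp: p Suc_le_eq)
  then have s2: "(\<lambda>n. (if n = 0 then 0 else a (- int n)) * (1 / x) ^ n) summable_on UNIV"
    using s(2) by simp
  have "(\<Sum>\<^sub>\<infinity>m\<in>{1..}. a (- int m) * x powi (- int m)) =
      (\<Sum>\<^sub>\<infinity>n. (if n = 0 then 0 else a (- int n)) * (1 / x) ^ n)"
    by (rule infsum_cong_neutral) (auto simp: p Suc_le_eq)
  then show ?thesis
    unfolding laurent_sum_def s(3)
    using summable_on_UNIV_nat_suminf(2)[OF s(1)] summable_on_UNIV_nat_suminf(2)[OF s2] by simp
qed

lemma open_annulus: "open {x :: complex. r < norm x \<and> norm x < s}"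
  by (intro open_Collect_conj open_Collect_less continuous_intros)

text \<open>Each half is differentiated as a power series. In the half in \<open>1 / x\<close> the
  chain rule supplies the sign that turns the weight \<open>n\<close> into the index
  \<open>- n\<close>.\<close>

lemma laurent_sum_derivative:
  assumes R: "0 < R" "R < 1" and a: "annular R a" and x: "R < norm x" "norm x < 1 / R"
  shows "(laurent_sum a has_field_derivative laurent_sum (\<lambda>n. of_int n * a n) x / x) (at x)"
proof -
  define b where "b n = (if n = 0 then 0 else a (- int n))" for n
  have x0: "x \<noteq> 0" using x R by auto
  have K: "norm (1 / x) < 1 / R"
    unfolding norm_divide norm_one by (rule divide_strict_left_mono) (use x R x0 in auto)
  have sb: "summable (\<lambda>n. b n * z ^ n)" if "norm z < 1 / R" for z
  proof -
    have "summable (\<lambda>n. a (- int n) * z ^ n)"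
      using annular_powser[OF R annular_reflect[OF R(1) a] that] by simp
    then have "summable (\<lambda>n. a (- int (Suc n)) * z ^ Suc n)"
      by (subst summable_Suc_iff)
    then have "summable (\<lambda>n. b (Suc n) * z ^ Suc n)" by (simp add: b_def)
    then show ?thesis by (subst (asm) summable_Suc_iff)
  qed
  have d1: "((\<lambda>z. \<Sum>n. a (int n) * z ^ n) has_field_derivative
      (\<Sum>n. of_nat n * a (int n) * x ^ n) / x) (at x)"
    by (rule power_series_log_derivative[OF annular_powser[OF R a] x(2) x0])
  have "((\<lambda>z. \<Sum>n. b n * z ^ n) has_field_derivative
      (\<Sum>n. of_nat n * b n * (1 / x) ^ n) / (1 / x)) (at (1 / x))"
    by (rule power_series_log_derivative[OF sb K]) (use x0 in auto)
  then have d2: "((\<lambda>z. \<Sum>n. b n * (1 / z) ^ n) has_field_derivative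
      (\<Sum>n. of_nat n * b n * (1 / x) ^ n) / (1 / x) * (- 1 / x\<^sup>2)) (at x)"
    by (rule DERIV_chain2) (use x0 in \<open>auto intro!: derivative_eq_intros simp: power2_eq_square\<close>)
  have "(\<Sum>n. (if n = 0 then 0 else of_int (- int n) * a (- int n)) * (1 / x) ^ n) =
      (\<Sum>n. - (of_nat n * b n * (1 / x) ^ n))"
    by (rule arg_cong[where f = suminf]) (auto simp: b_def)
  also have "\<dots> = - (\<Sum>n. of_nat n * b n * (1 / x) ^ n)"
  proof (rule suminf_minus)
    have "summable (\<lambda>n. - of_int (int n) * b n * (1/x)^n)"
    proof -
      have "summable (\<lambda>n. of_int (- int n) * a (- int n) * (1 / x) ^ n)"
        using annular_powser[OF R annular_reflect[OF R(1) annular_times_index[OF R(1) a]] K] by simp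
      then show ?thesis by (rule summable_cong[THEN iffD1, rotated]) (auto simp: b_def intro!: always_eventually)
    qed
    then show "summable (\<lambda>n. of_nat n * b n * (1 / x) ^ n)"
      using summable_minus_iff by fastforce
  qed
  finally have eq: "laurent_sum (\<lambda>n. of_int n * a n) x =
      (\<Sum>n. of_nat n * a (int n) * x ^ n) - (\<Sum>n. of_nat n * b n * (1 / x) ^ n)"
    using laurent_sum_conv_powser[OF R annular_times_index[OF R(1) a] x] by simp
  have "((\<lambda>z. (\<Sum>n. a (int n) * z ^ n) + (\<Sum>n. b n * (1 / z) ^ n)) has_field_derivative
     laurent_sum (\<lambda>n. of_int n * a n) x / x) (at x)"
    by (rule DERIV_cong[OF DERIV_add[OF d1 d2]]) (use x0 in \<open>simp add: eq field_simps power2_eq_square\<close>)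
  then show ?thesis
  proof (rule has_field_derivative_transform_within_open[OF _ open_annulus])
    show "x \<in> {x. R < norm x \<and> norm x < 1 / R}" using x by simp
  qed (simp add: laurent_sum_conv_powser[OF R a] b_def)
qed

text \<open>The two halves are dominated by geometric series of ratios \<open>r * norm x\<close> and
  \<open>r / norm x\<close>, both below 1 in the annulus.\<close>

lemma annular_geometricI:
  assumes r: "0 < r" and a: "\<And>n. norm (a n) \<le> C * r ^ nat \<bar>n\<bar>"
  shows "annular r a"
  unfolding annular_def
proof (intro allI impI)
  fix x :: complex
  assume x: "r < norm x \<and> norm x < 1 / r"
  have x0: "norm x > 0" using x r by linarith
  have geo: "(\<lambda>m. C * z ^ m) summable_on A" if "0 \<le> z" "z < 1" for z :: real and A :: "nat set"
    using that norm_summable_imp_summable_on[of "\<lambda>m. z ^ m"] summable_on_subset[of _ UNIV A]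
    by (intro summable_on_cmult_right) (auto simp: norm_power summable_geometric)
  show "(\<lambda>n. a n * x powi n) summable_on UNIV"
  proof (rule summable_on_intI)
    show "(\<lambda>m. a (int m) * x powi int m) summable_on UNIV"
    proof (rule summable_on_complex_comparison[OF geo[of "r * norm x"]])
      show "norm (a (int m) * x powi int m) \<le> C * (r * norm x) ^ m" for m
        using mult_right_mono[OF a[of "int m"], of "norm x ^ m"]
        by (simp add: norm_mult norm_power power_mult_distrib mult_ac)
    qed (use x r x0 in \<open>auto simp: field_simps\<close>)
    show "(\<lambda>m. a (- int m) * x powi (- int m)) summable_on {1..}"
    proof (rule summable_on_complex_comparison[OF geo[of "r / norm x"]])
      show "norm (a (- int m) * x powi (- int m)) \<le> C * (r / norm x) ^ m" for m
        using mult_right_mono[OF a[of "- int m"], of "1 / norm x ^ m"] x0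
        by (simp add: norm_mult norm_power norm_inverse norm_divide power_int_minus divide_inverse power_mult_distrib power_inverse mult_ac)
    qed (use x r x0 in \<open>auto simp: field_simps\<close>)
  qed
qed

section \<open>Lambert series with a pole on the unit circle\<close>

text \<open>These polynomials in u = 1/(1 - x) represent the sums of \<open>n ^ k * x ^ n\<close>
  over \<open>n \<ge> 0\<close>. The recursion is x d/dx written in the variable u, since x du/dx =
  u^2 - u.\<close>

fun pole_poly :: "nat \<Rightarrow> complex poly" where
  "pole_poly 0 = [:0, 1:]"
| "pole_poly (Suc k) = [:0, - 1, 1:] * pderiv (pole_poly k)"

lemma pole_poly_derivative:
  assumes "x \<noteq> 1" "x \<noteq> 0"
  shows "((\<lambda>x. poly (pole_poly k) (1 / (1 - x))) has_field_derivative
    poly (pole_poly (Suc k)) (1 / (1 - x)) / x) (at x)"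
proof -
  have "((\<lambda>x. poly (pole_poly k) (1 / (1 - x))) has_field_derivative
    poly (pderiv (pole_poly k)) (1 / (1 - x)) * (1 / (1 - x)\<^sup>2)) (at x)"
    by (rule DERIV_chain2[OF poly_DERIV])
       (use assms in \<open>auto intro!: derivative_eq_intros simp: power2_eq_square\<close>)
  moreover have "1 / (1 - x)\<^sup>2 = (- (1 / (1 - x)) + (1 / (1 - x))\<^sup>2) / x"
    using assms by (simp add: divide_simps power2_eq_square)
  then have "poly (pderiv (pole_poly k)) (1 / (1 - x)) * (1 / (1 - x)\<^sup>2) = poly (pole_poly (Suc k)) (1 / (1 - x)) / x"
    by (simp only:) (simp add: algebra_simps power2_eq_square diff_divide_distrib)
  ultimately show ?thesis by (simp only:)
qed

lemma summable_power_weights: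
  fixes x :: complex
  assumes "norm x < 1"
  shows "summable (\<lambda>n. norm (of_nat n ^ k * x ^ n))"
proof -
  have s: "summable (\<lambda>n. of_nat n ^ k * z ^ n)" if "norm z < 1" for z :: complex
    using that
  proof (induction k arbitrary: z)
    case 0
    then show ?case by (simp add: summable_geometric)
  next
    case (Suc k)
    have "summable (\<lambda>n. diffs (\<lambda>n. of_nat n ^ k) n * z ^ n)"
      by (rule termdiff_converges[OF Suc.prems Suc.IH])
    then have "summable (\<lambda>n. z * (diffs (\<lambda>n. of_nat n ^ k) n * z ^ n))"
      by (rule summable_mult)
    then have "summable (\<lambda>n. of_nat (Suc n) ^ Suc k * z ^ Suc n)"
      by (simp add: diffs_def mult_ac del: of_nat_Suc)
    then show ?case by (subst (asm) summable_Suc_iff)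
  qed
  obtain t where t: "norm x < t" "t < 1" using assms dense by blast
  then have n: "norm (complex_of_real t) = t" by (smt (verit) norm_ge_zero norm_of_real)
  show ?thesis
    by (rule powser_insidea[OF s[of "complex_of_real t"]]) (use t n in auto)
qed

text \<open>Induction on \<open>k\<close>: the derivative of case \<open>k\<close> is computed
  termwise and from the closed form, and uniqueness of derivatives equates the two.\<close>

lemma power_weights_sums:
  fixes x :: complex
  assumes "norm x < 1" "x \<noteq> 0"
  shows "(\<Sum>n. of_nat n ^ k * x ^ n) = poly (pole_poly k) (1 / (1 - x))"
  using assms
proof (induction k arbitrary: x)
  case 0
  then show ?case by (simp add: suminf_geometric)
next
  case (Suc k)
  have "((\<lambda>z. \<Sum>n. of_nat n ^ k * z ^ n) has_field_derivative
      (\<Sum>n. of_nat n * of_nat n ^ k * x ^ n) / x) (at x)"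
    by (rule power_series_log_derivative[where K = 1])
       (use Suc.prems summable_norm_cancel[OF summable_power_weights] in auto)
  moreover have "((\<lambda>z. \<Sum>n. of_nat n ^ k * z ^ n) has_field_derivative
     poly (pole_poly (Suc k)) (1 / (1 - x)) / x) (at x)"
  proof (rule has_field_derivative_transform_within_open[OF pole_poly_derivative])
    show "open (ball 0 1 - {0 :: complex})" by auto
    show "x \<in> ball 0 1 - {0}" using Suc.prems by auto
  qed (use Suc in auto)
  ultimately have "(\<Sum>n. of_nat n * of_nat n ^ k * x ^ n) / x = poly (pole_poly (Suc k)) (1 / (1 - x)) / x"
    by (rule DERIV_unique)
  then have "(\<Sum>n. of_nat n * of_nat n ^ k * x ^ n) = poly (pole_poly (Suc k)) (1 / (1 - x))"
    using Suc.prems by (simp only: divide_cancel_right simp_thms)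
  then show ?case by (simp only: power_Suc)
qed

text \<open>The two-sided series with coefficients \<open>b\<close>, weighted by \<open>n ^ k\<close>, continued from
  the annulus inside the unit circle across its pole at 1; requires \<open>b n\<close> to decay as
  \<open>n \<rightarrow> -\<infinity>\<close> and to tend to 1 as \<open>n \<rightarrow> \<infinity>\<close>.\<close>

definition tail :: "(int \<Rightarrow> complex) \<Rightarrow> int \<Rightarrow> complex" where
  "tail b n = b n - of_bool (0 \<le> n)"

definition pole_series :: "(int \<Rightarrow> complex) \<Rightarrow> nat \<Rightarrow> complex \<Rightarrow> complex" where
  "pole_series b k x = poly (pole_poly k) (1 / (1 - x)) + laurent_sum (\<lambda>n. of_int n ^ k * tail b n) x"

lemma pole_series_derivative:
  assumes R: "0 < R" "R < 1" and b: "annular R (tail b)"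
    and x: "R < norm x" "norm x < 1 / R" "x \<noteq> 1"
  shows "(pole_series b k has_field_derivative pole_series b (Suc k) x / x) (at x)"
proof -
  have "x \<noteq> 0" using R x by auto
  have "((\<lambda>x. poly (pole_poly k) (1 / (1 - x)) + laurent_sum (\<lambda>n. of_int n ^ k * tail b n) x)
     has_field_derivative (poly (pole_poly (Suc k)) (1 / (1 - x)) / x
        + laurent_sum (\<lambda>n. of_int n * (of_int n ^ k * tail b n)) x / x)) (at x)"
    by (intro DERIV_add pole_poly_derivative laurent_sum_derivative annular_times_index_power) fact+
  then show ?thesis
    by (simp add: pole_series_def[abs_def] add_divide_distrib mult.assoc)
qed

text \<open>Inside the unit circle the polynomial in \<open>1 / (1 - x)\<close> expands as the sum
  of \<open>n ^ k * x ^ n\<close> over \<open>n \<ge> 0\<close>, which restores the unit step that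
  \<open>tail\<close> removes from the coefficients.\<close>

lemma pole_series_has_sum:
  assumes R: "0 < R" "R < 1" and b: "annular R (tail b)" and x: "R < norm x" "norm x < 1"
  shows "((\<lambda>n. of_int n ^ k * b n * x powi n) has_sum pole_series b k x) UNIV"
proof -
  have x0: "x \<noteq> 0" using R x by auto
  have "1 < 1 / R" using R by simp
  then have x': "norm x < 1 / R" using x by linarith
  have "(\<lambda>n. of_nat n ^ k * x ^ n) sums poly (pole_poly k) (1 / (1 - x))"
    using summable_sums[OF summable_norm_cancel[OF summable_power_weights[OF x(2), of k]]]
      power_weights_sums[OF x(2) x0] by simp
  then have "((\<lambda>n. of_nat n ^ k * x ^ n) has_sum poly (pole_poly k) (1 / (1 - x))) UNIV"
    by (rule norm_summable_imp_has_sum[OF summable_power_weights[OF x(2)]])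
  then have "((\<lambda>n. of_int n ^ k * x powi n) has_sum poly (pole_poly k) (1 / (1 - x))) (range int)"
    by (subst has_sum_reindex) (auto simp: o_def)
  then have s1: "((\<lambda>n. of_int n ^ k * of_bool (0 \<le> n) * x powi n) has_sum poly (pole_poly k) (1 / (1 - x))) UNIV"
    by (rule has_sum_cong_neutral[THEN iffD1, rotated -1]) (auto simp: image_iff dest: zero_le_imp_eq_int)
  have s2: "((\<lambda>n. of_int n ^ k * tail b n * x powi n) has_sum laurent_sum (\<lambda>n. of_int n ^ k * tail b n) x) UNIV"
    unfolding laurent_sum_def
    by (intro has_sum_infsum annularD[OF annular_times_index_power[OF R(1) b] x(1) x'])
  show ?thesis
    using has_sum_add[OF s1 s2] by (simp add: pole_series_def tail_def algebra_simps)
qed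

text \<open>In use, \<open>a\<close> and \<open>b\<close> are \<open>q powi k\<close> and
  \<open>q powi (n - k)\<close>, so that \<open>a * b = q powi n\<close>. The shape
  \<open>1 - 1 / (1 + b)\<close> is kept because it then equals \<open>sg q (k - n)\<close>.\<close>

lemma partial_fractions:
  fixes a b :: complex
  shows "\<lbrakk>1 - a * b \<noteq> 0; 1 + a \<noteq> 0; 1 + b \<noteq> 0\<rbrakk> \<Longrightarrow>
      1 / (1 + a) * (1 / (1 + b)) = (1 / (1 + a) - (1 - 1 / (1 + b))) * (1 / (1 - a * b))"
    and "\<lbrakk>1 + a * b \<noteq> 0; 1 - a \<noteq> 0; 1 + b \<noteq> 0\<rbrakk> \<Longrightarrow>
      1 / (1 + a * b) * (c * (1 / (1 - a) - (1 - 1 / (1 + b)))) = c * (1 / (1 - a)) * (1 / (1 + b))"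
proof -
  show "1 / (1 + a) * (1 / (1 + b)) = (1 / (1 + a) - (1 - 1 / (1 + b))) * (1 / (1 - a * b))"
    if h: "1 - a * b \<noteq> 0" "1 + a \<noteq> 0" "1 + b \<noteq> 0"
  proof -
    have "1 / (1 + a) - (1 - 1 / (1 + b)) = (1 - a * b) / ((1 + a) * (1 + b))"
      using h(2,3) by (simp add: field_simps)
    then show ?thesis using h(1) by simp
  qed
  show "1 / (1 + a * b) * (c * (1 / (1 - a) - (1 - 1 / (1 + b)))) = c * (1 / (1 - a)) * (1 / (1 + b))"
    if h: "1 + a * b \<noteq> 0" "1 - a \<noteq> 0" "1 + b \<noteq> 0"
  proof -
    have "1 / (1 - a) - (1 - 1 / (1 + b)) = (1 + a * b) / ((1 - a) * (1 + b))"
      using h(2,3) by (simp add: field_simps)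
    then show ?thesis using h(1) by simp
  qed
qed

section \<open>The coefficients \<open>sg\<close> and \<open>rho\<close> and their
  convolutions\<close>

definition sg :: "complex \<Rightarrow> int \<Rightarrow> complex" where
  "sg q n = 1 / (1 + q powi n)"

text \<open>At \<open>n = 0\<close> the division gives \<open>rho q 0 = 0\<close>; only \<open>n * rho q n\<close> matters.\<close>

definition rho :: "complex \<Rightarrow> int \<Rightarrow> complex" where
  "rho q n = 1 / (1 - q powi n)"

context
  fixes q :: complex
  assumes q: "0 < norm q" "norm q < 1"
begin

lemma q_nonzero: "q \<noteq> 0" using q by auto

lemma norm_q_powi: "n \<noteq> 0 \<Longrightarrow> norm (q powi n) \<noteq> 1"
proof -
  have "norm q ^ m < 1" if "m > 0" for m :: nat
    using q that by (simp add: power_less_one_iff)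
  then show "n \<noteq> 0 \<Longrightarrow> norm (q powi n) \<noteq> 1"
    by (cases n rule: int_cases2) (auto simp: norm_power norm_inverse power_int_minus less_imp_neq)
qed

lemma one_plus_powi_nonzero: "1 + q powi n \<noteq> 0"
proof (cases "n = 0")
  case False
  then have "norm (q powi n) \<noteq> norm (- 1 :: complex)" using norm_q_powi by simp
  then show ?thesis by (metis add_eq_0_iff)
qed simp

lemma one_minus_powi_nonzero: "n \<noteq> 0 \<Longrightarrow> 1 - q powi n \<noteq> 0"
  using norm_q_powi[of n] by (metis eq_iff_diff_eq_0 norm_one)

lemma q_powi_nonzero: "q powi n \<noteq> 0" using q_nonzero by simp

lemma sg_minus: "sg q (- n) = 1 - sg q n"
  using one_plus_powi_nonzero[of n] one_plus_powi_nonzero[of "- n"] q_powi_nonzero[of n]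
  by (simp add: sg_def power_int_minus divide_simps)

lemma rho_minus: "n \<noteq> 0 \<Longrightarrow> rho q (- n) = 1 - rho q n"
  using one_minus_powi_nonzero[of n] one_minus_powi_nonzero[of "- n"] q_powi_nonzero[of n]
  by (simp add: rho_def power_int_minus divide_simps) (simp add: algebra_simps)

lemma norm_one_pm_ge: "m \<ge> 1 \<Longrightarrow> 1 - norm q \<le> norm (1 + q ^ m)" "m \<ge> 1 \<Longrightarrow> 1 - norm q \<le> norm (1 - q ^ m)"
proof -
  assume "m \<ge> 1"
  then have "norm (q ^ m) \<le> norm q"
    using power_decreasing[of 1 m "norm q"] q by (simp add: norm_power)
  then show "1 - norm q \<le> norm (1 + q ^ m)" "1 - norm q \<le> norm (1 - q ^ m)"
    using norm_triangle_ineq4[of "1 + q ^ m" "q ^ m"] norm_triangle_ineq[of "1 - q ^ m" "q ^ m"] by auto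
qed

lemma tail_pos: "m \<ge> 1 \<Longrightarrow> tail (sg q) (int m) = - (q ^ m / (1 + q ^ m))"
  "m \<ge> 1 \<Longrightarrow> tail (rho q) (int m) = q ^ m / (1 - q ^ m)"
  using one_plus_powi_nonzero[of "int m"] one_minus_powi_nonzero[of "int m"]
  by (auto simp: tail_def sg_def rho_def divide_simps)

text \<open>Together with the formulas at positive indices this shows that both tails are odd away
  from 0. Up to sign and weight their values are the summands of the Lambert series.\<close>

lemma tail_neg: "m \<ge> 1 \<Longrightarrow> tail (sg q) (- int m) = q ^ m / (1 + q ^ m)"
  "m \<ge> 1 \<Longrightarrow> tail (rho q) (- int m) = - (q ^ m / (1 - q ^ m))"
  using tail_pos[of m] by (auto simp: tail_def sg_minus rho_minus algebra_simps)

lemma tail_zero: "tail (sg q) 0 = - 1 / 2" "tail (rho q) 0 = - 1"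
  by (auto simp: tail_def sg_def rho_def)

lemma annular_tail: "annular (norm q) (tail (sg q))" "annular (norm q) (tail (rho q))"
proof -
  have b: "norm (q ^ m / (1 + q ^ m)) \<le> 1 / (1 - norm q) * norm q ^ m"
    "norm (q ^ m / (1 - q ^ m)) \<le> 1 / (1 - norm q) * norm q ^ m" if "m \<ge> 1" for m
    using norm_one_pm_ge[OF that] q by (auto simp: norm_divide norm_power intro!: divide_left_mono mult_pos_pos)
  \<comment> \<open>This covers the index 0, where the tails are \<open>- 1 / 2\<close> and
    \<open>- 1\<close>.\<close>
  have c: "1 \<le> 1 / (1 - norm q)" using q by simp
  have n: "n = 0 \<or> (\<exists>m\<ge>1. n = int m \<or> n = - int m)" for n
    by (cases n rule: int_cases2) (auto simp: Suc_le_eq)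
  show "annular (norm q) (tail (sg q))"
  proof (rule annular_geometricI[OF q(1)])
    show "norm (tail (sg q) n) \<le> 1 / (1 - norm q) * norm q ^ nat \<bar>n\<bar>" for n
      using n[of n] b(1) c by (elim disjE exE conjE) (simp_all add: tail_pos tail_neg tail_zero)
  qed
  show "annular (norm q) (tail (rho q))"
  proof (rule annular_geometricI[OF q(1)])
    show "norm (tail (rho q) n) \<le> 1 / (1 - norm q) * norm q ^ nat \<bar>n\<bar>" for n
      using n[of n] b(2) c by (elim disjE exE conjE) (simp_all add: tail_pos tail_neg tail_zero)
  qed
qed

lemma summable_weighted_tail:
  "(\<lambda>n. of_int n ^ k * tail (sg q) n) summable_on UNIV"
  "(\<lambda>n. of_int n ^ k * tail (rho q) n) summable_on UNIV"
  using annularD[OF annular_times_index_power[OF q(1) annular_tail(1), of k], of 1]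
    annularD[OF annular_times_index_power[OF q(1) annular_tail(2), of k], of 1] q
  by simp_all

text \<open>The tail is odd away from 0, so only the term at index 0 survives.\<close>

lemma infsum_tail_sg: "infsum (tail (sg q)) UNIV = - 1 / 2"
proof -
  have "tail (sg q) summable_on UNIV" using summable_weighted_tail(1)[of 0] by simp
  then have "infsum (tail (sg q)) UNIV = - 1 / 2 + (\<Sum>\<^sub>\<infinity>m\<in>{1..}. tail (sg q) (int m) + tail (sg q) (- int m))"
    by (simp add: infsum_int_pairs tail_zero)
  also have "(\<Sum>\<^sub>\<infinity>m\<in>{1..}. tail (sg q) (int m) + tail (sg q) (- int m)) = 0"
    by (rule infsum_0) (simp add: tail_pos tail_neg)
  finally show ?thesis by simp
qed

text \<open>The difference of the two steps is the indicator of \<open>{0..<n}\<close>, or minus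
  that of \<open>{n..<0}\<close> for negative \<open>n\<close>, so the sum telescopes to
  \<open>T n - T 0\<close>.\<close>

lemma has_sum_step_difference:
  fixes g T :: "int \<Rightarrow> complex"
  assumes T: "T 0 = 0" "\<And>n. T (n + 1) = T n + g n"
  shows "((\<lambda>k. g k * (of_bool (0 \<le> k) - of_bool (n \<le> k))) has_sum T n) UNIV"
proof -
  have single: "((\<lambda>k. if k = n then g n else 0) has_sum g n) UNIV" for n
    by (rule has_sum_finite_neutralI[where B = "{n}"]) auto
  show ?thesis
  proof (induction n rule: int_induct[where k = 0])
    case base
    then show ?case by (simp add: T)
  next
    case (step1 n)
    from has_sum_add[OF this(2) single[of n], folded T(2)] show ?case
      by (rule has_sum_cong[THEN iffD1, rotated]) auto
  next
    case (step2 n)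
    have "T n = T (n - 1) + g (n - 1)" using T(2)[of "n - 1"] by simp
    then have t: "T n + - g (n - 1) = T (n - 1)" by simp
    from has_sum_add[OF step2(2) has_sum_uminusI[OF single[of "n - 1"]], unfolded t] show ?case
      by (rule has_sum_cong[THEN iffD1, rotated]) auto
  qed
qed

text \<open>With \<open>sg\<close> written as tail plus unit step, the two tail sums cancel by
  translation invariance, and the steps differ at \<open>n\<close> indices, counted with
  sign.\<close>

lemma has_sum_sg_difference: "((\<lambda>k. sg q k - sg q (k - n)) has_sum of_int n) UNIV"
proof -
  have s: "tail (sg q) summable_on UNIV" using summable_weighted_tail(1)[of 0] by simp
  have "((\<lambda>k. tail (sg q) (k + - n)) has_sum infsum (tail (sg q)) UNIV) UNIV"
    using s by (subst has_sum_int_shift) simp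
  from has_sum_add[OF has_sum_add[OF has_sum_infsum[OF s] has_sum_uminusI[OF this]]
      has_sum_step_difference[where T = of_int and g = "\<lambda>_. 1" and n = n]]
  show ?thesis by (simp add: tail_def algebra_simps)
qed

text \<open>Partial fractions turn the convolution into \<open>rho q n\<close> times a sum of
  differences of shifted copies, whose value is \<open>n\<close>. The excluded case
  \<open>n = 0\<close> becomes the constant in the formula for the square.\<close>

lemma sg_convolution:
  assumes "n \<noteq> 0"
  shows "((\<lambda>k. sg q k * sg q (n - k)) has_sum (of_int n * rho q n)) UNIV"
proof -
  have "sg q k * sg q (n - k) = (sg q k - sg q (k - n)) * rho q n" for k
  proof -
    have c: "q powi n = q powi k * q powi (n - k)" using q_nonzero by (simp flip: power_int_add)
    have m: "sg q (k - n) = 1 - sg q (n - k)" using sg_minus[of "n - k"] by simp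
    show ?thesis
      using one_minus_powi_nonzero[OF assms] one_plus_powi_nonzero[of k] one_plus_powi_nonzero[of "n - k"]
      unfolding m unfolding sg_def rho_def c by (intro partial_fractions) auto
  qed
  then show ?thesis
    using has_sum_cmult_left[OF has_sum_sg_difference[of n], of "rho q n"] by simp
qed

text \<open>After partial fractions, \<open>k * (rho q k - sg q (k - n))\<close> is split into tails
  and steps. The shift of the tail contributes \<open>n / 2\<close> and the steps
  \<open>n * (n - 1) / 2\<close>; the linear terms cancel, and the pure square left over later
  becomes a second derivative.\<close>

lemma rho_sg_convolution:
  obtains K where "\<And>n. ((\<lambda>k. of_int k * rho q k * sg q (n - k)) has_sum (sg q n * (K + of_int n ^ 2 / 2))) UNIV"
proof
  fix n :: int
  define K1 where "K1 = (\<Sum>\<^sub>\<infinity>k. of_int k * tail (rho q) k)"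
  define K2 where "K2 = (\<Sum>\<^sub>\<infinity>k. of_int k * tail (sg q) k)"
  have s1: "((\<lambda>k. of_int k * tail (rho q) k) has_sum K1) UNIV"
    and s2: "((\<lambda>k. of_int k * tail (sg q) k) has_sum K2) UNIV"
    using summable_weighted_tail[of 1] by (simp_all add: K1_def K2_def)
  have s0: "(tail (sg q) has_sum (- 1 / 2)) UNIV"
    using summable_weighted_tail(1)[of 0] infsum_tail_sg by (simp add: has_sum_iff)
  have "((\<lambda>j. (of_int j + of_int n) * tail (sg q) j) has_sum (K2 + of_int n * (- 1 / 2))) UNIV"
    using has_sum_add[OF s2 has_sum_cmult_right[OF s0, of "of_int n"]] by (simp add: algebra_simps)
  then have "((\<lambda>k. (of_int (k + - n) + of_int n) * tail (sg q) (k + - n)) has_sum (K2 + of_int n * (- 1 / 2))) UNIV"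
    by (subst has_sum_int_shift[of "\<lambda>j. (of_int j + of_int n) * tail (sg q) j"])
  then have s3: "((\<lambda>k. of_int k * tail (sg q) (k - n)) has_sum (K2 - of_int n / 2)) UNIV" by simp
  have s4: "((\<lambda>k. of_int k * (of_bool (0 \<le> k) - of_bool (n \<le> k))) has_sum (of_int n * (of_int n - 1) / 2 :: complex)) UNIV"
    by (rule has_sum_step_difference) (auto simp: field_simps)
  have "K1 + - (K2 - of_int n / 2) + of_int n * (of_int n - 1) / 2 = K1 - K2 + of_int n ^ 2 / 2"
    by (simp add: field_simps power2_eq_square)
  from has_sum_add[OF has_sum_add[OF s1 has_sum_uminusI[OF s3]] s4, unfolded this]
  have "((\<lambda>k. of_int k * (rho q k - sg q (k - n))) has_sum (K1 - K2 + of_int n ^ 2 / 2)) UNIV"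
    by (rule has_sum_cong[THEN iffD1, rotated])
       (auto simp: tail_def algebra_simps)
  from has_sum_cmult_right[OF this, of "sg q n"]
  have "((\<lambda>k. sg q n * (of_int k * (rho q k - sg q (k - n)))) has_sum (sg q n * (K1 - K2 + of_int n ^ 2 / 2))) UNIV" .
  moreover have "sg q n * (of_int k * (rho q k - sg q (k - n))) = of_int k * rho q k * sg q (n - k)" for k
  proof (cases "k = 0")
    case False
    have c: "q powi n = q powi k * q powi (n - k)" using q_nonzero by (simp flip: power_int_add)
    have m: "sg q (k - n) = 1 - sg q (n - k)" using sg_minus[of "n - k"] by simp
    show ?thesis
      using one_minus_powi_nonzero[OF False] one_plus_powi_nonzero[of n] one_plus_powi_nonzero[of "n - k"]
      unfolding m unfolding sg_def rho_def c by (intro partial_fractions) auto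
  qed simp
  ultimately show "((\<lambda>k. of_int k * rho q k * sg q (n - k)) has_sum
     (sg q n * ((\<Sum>\<^sub>\<infinity>k. of_int k * tail (rho q) k) - (\<Sum>\<^sub>\<infinity>k. of_int k * tail (sg q) k) + of_int n ^ 2 / 2))) UNIV"
    by (simp add: K1_def K2_def)
qed

text \<open>The full coefficients tend to 1 as \<open>n\<close> grows, so their series require
  \<open>norm x < 1\<close>. Identities are proved here by comparing coefficients and then carried
  to the unit circle by continuity.\<close>

definition "inner_annulus = {x :: complex. norm q < norm x \<and> norm x < 1}"

text \<open>In the Cauchy product the coefficients away from index 0 are those of h; the one at
  index 0 is the constant \<open>c\<close>, which remains unevaluated.\<close>

lemma pole_series_sg_square:
  obtains c where "\<And>x. x \<in> inner_annulus \<Longrightarrow> pole_series (sg q) 0 x ^ 2 = c + pole_series (rho q) 1 x"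
proof
  fix x assume "x \<in> inner_annulus"
  then have x: "norm q < norm x" "norm x < 1" and x0: "x \<noteq> 0" by (auto simp: inner_annulus_def)
  have f: "((\<lambda>n. sg q n * x powi n) has_sum pole_series (sg q) 0 x) UNIV"
    using pole_series_has_sum[OF q annular_tail(1) x, of 0] by simp
  have h: "((\<lambda>n. of_int n * rho q n * x powi n) has_sum pole_series (rho q) 1 x) UNIV"
    using pole_series_has_sum[OF q annular_tail(2) x, of 1] by simp
  let ?c = "\<Sum>\<^sub>\<infinity>k. sg q k * sg q (0 - k)"
  have "((\<lambda>n. \<Sum>\<^sub>\<infinity>k. sg q k * x powi k * (sg q (n - k) * x powi (n - k))) has_sum pole_series (sg q) 0 x ^ 2) UNIV"
    using int_convolution(2)[OF has_sum_imp_summable[OF f] has_sum_imp_summable[OF f]] f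
    by (simp add: has_sum_iff power2_eq_square)
  moreover have "(\<Sum>\<^sub>\<infinity>k. sg q k * x powi k * (sg q (n - k) * x powi (n - k))) =
      (if n = 0 then ?c else 0) + of_int n * rho q n * x powi n" for n
  proof -
    have "sg q k * x powi k * (sg q (n - k) * x powi (n - k)) = sg q k * sg q (n - k) * x powi n" for k
      using x0 by (simp flip: power_int_add)
    then have "(\<Sum>\<^sub>\<infinity>k. sg q k * x powi k * (sg q (n - k) * x powi (n - k))) =
       (\<Sum>\<^sub>\<infinity>k. sg q k * sg q (n - k)) * x powi n"
      by (simp only: infsum_cmult_left')
    then show ?thesis using sg_convolution[of n] by (auto simp: has_sum_iff)
  qed
  moreover have "((\<lambda>n. if n = 0 then ?c else 0) has_sum ?c) (UNIV :: int set)"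
    by (rule has_sum_finite_neutralI[where B = "{0}"]) auto
  ultimately show "pole_series (sg q) 0 x ^ 2 = ?c + pole_series (rho q) 1 x"
    using has_sum_unique[OF _ has_sum_add[OF _ h]] by simp
qed

text \<open>The Cauchy product again: the summand \<open>n ^ 2 / 2\<close> in the convolution
  produces half the second log-derivative of f.\<close>

lemma pole_series_product:
  obtains K where "\<And>x. x \<in> inner_annulus \<Longrightarrow>
    pole_series (rho q) 1 x * pole_series (sg q) 0 x = K * pole_series (sg q) 0 x + pole_series (sg q) 2 x / 2"
proof -
  obtain K where K: "\<And>n. ((\<lambda>k. of_int k * rho q k * sg q (n - k)) has_sum (sg q n * (K + of_int n ^ 2 / 2))) UNIV"
    using rho_sg_convolution by blast
  show ?thesis
  proof
    fix x assume "x \<in> inner_annulus"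
    then have x: "norm q < norm x" "norm x < 1" and x0: "x \<noteq> 0" by (auto simp: inner_annulus_def)
    have f: "((\<lambda>n. sg q n * x powi n) has_sum pole_series (sg q) 0 x) UNIV"
      using pole_series_has_sum[OF q annular_tail(1) x, of 0] by simp
    have f2: "((\<lambda>n. of_int n ^ 2 * sg q n * x powi n) has_sum pole_series (sg q) 2 x) UNIV"
      using pole_series_has_sum[OF q annular_tail(1) x, of 2] by simp
    have h: "((\<lambda>n. of_int n * rho q n * x powi n) has_sum pole_series (rho q) 1 x) UNIV"
      using pole_series_has_sum[OF q annular_tail(2) x, of 1] by simp
    have "((\<lambda>n. \<Sum>\<^sub>\<infinity>k. of_int k * rho q k * x powi k * (sg q (n - k) * x powi (n - k))) has_sum
        (pole_series (rho q) 1 x * pole_series (sg q) 0 x)) UNIV"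
      using int_convolution(2)[OF has_sum_imp_summable[OF h] has_sum_imp_summable[OF f]] f h
      by (simp add: has_sum_iff)
    moreover have "(\<Sum>\<^sub>\<infinity>k. of_int k * rho q k * x powi k * (sg q (n - k) * x powi (n - k))) =
        K * (sg q n * x powi n) + 1 / 2 * (of_int n ^ 2 * sg q n * x powi n)" for n
    proof -
      have "of_int k * rho q k * x powi k * (sg q (n - k) * x powi (n - k)) =
         of_int k * rho q k * sg q (n - k) * x powi n" for k
        using x0 by (simp flip: power_int_add)
      then have "(\<Sum>\<^sub>\<infinity>k. of_int k * rho q k * x powi k * (sg q (n - k) * x powi (n - k))) =
         (\<Sum>\<^sub>\<infinity>k. of_int k * rho q k * sg q (n - k)) * x powi n"
        by (simp only: infsum_cmult_left')
      also have "(\<Sum>\<^sub>\<infinity>k. of_int k * rho q k * sg q (n - k)) = sg q n * (K + of_int n ^ 2 / 2)"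
        using K[of n] by (simp add: has_sum_iff)
      finally show ?thesis by (simp add: algebra_simps)
    qed
    ultimately have "((\<lambda>n. K * (sg q n * x powi n) + 1 / 2 * (of_int n ^ 2 * sg q n * x powi n)) has_sum
        (pole_series (rho q) 1 x * pole_series (sg q) 0 x)) UNIV" by simp
    from has_sum_unique[OF this has_sum_add[OF has_sum_cmult_right[OF f, of K] has_sum_cmult_right[OF f2, of "1/2"]]]
    show "pole_series (rho q) 1 x * pole_series (sg q) 0 x = K * pole_series (sg q) 0 x + pole_series (sg q) 2 x / 2"
      by simp
  qed
qed

end

section \<open>Differentiation at the boundary\<close>

context
  fixes q :: complex
  assumes q: "0 < norm q" "norm q < 1"
begin

text \<open>The boundary point is approached radially, along \<open>t * z\<close> with
  \<open>t\<close> increasing to 1.\<close>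

lemma inner_annulus_boundary_unique:
  assumes eq: "\<And>x. x \<in> inner_annulus q \<Longrightarrow> F1 x = F2 x" and z: "norm z = 1" and "isCont F1 z" "isCont F2 z"
  shows "F1 z = (F2 z :: complex)"
proof -
  have lim: "((\<lambda>t. complex_of_real t * z) \<longlongrightarrow> complex_of_real 1 * z) (at_left 1)"
    by (intro tendsto_intros)
  have F1: "((\<lambda>t. F1 (complex_of_real t * z)) \<longlongrightarrow> F1 z) (at_left 1)"
    and F2: "((\<lambda>t. F2 (complex_of_real t * z)) \<longlongrightarrow> F2 z) (at_left 1)"
    using isCont_tendsto_compose[OF assms(3)] isCont_tendsto_compose[OF assms(4)] lim by auto
  have "\<forall>\<^sub>F t in at_left 1. t \<in> {norm q<..<1}"
    by (rule eventually_at_leftI[of "norm q"]) (use q in auto)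
  then have "\<forall>\<^sub>F t in at_left 1. F1 (complex_of_real t * z) = F2 (complex_of_real t * z)"
  proof eventually_elim
    case (elim t)
    moreover have "norm (complex_of_real t * z) = t"
      using elim z by (simp add: norm_mult) (smt (verit) norm_ge_zero)
    ultimately show ?case by (intro eq) (auto simp: inner_annulus_def[OF q])
  qed
  then have "((\<lambda>t. F2 (complex_of_real t * z)) \<longlongrightarrow> F1 z) (at_left 1)"
    using F1 by (rule Lim_transform_eventually[rotated])
  from tendsto_unique[OF _ this F2] show ?thesis by simp
qed

text \<open>Lets an identity on the open annulus be differentiated by x d/dx; the common factor
  \<open>1 / x\<close> cancels.\<close>

lemma inner_annulus_derivative_unique:
  assumes eq: "\<And>x. x \<in> inner_annulus q \<Longrightarrow> F1 x = F2 x"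
    and F1: "\<And>x. x \<in> inner_annulus q \<Longrightarrow> (F1 has_field_derivative F1' x / x) (at x)"
    and F2: "\<And>x. x \<in> inner_annulus q \<Longrightarrow> (F2 has_field_derivative F2' x / x) (at x)"
    and x: "x \<in> inner_annulus q"
  shows "F1' x = F2' x"
proof -
  have "open (inner_annulus q)" unfolding inner_annulus_def[OF q] by (rule open_annulus)
  from has_field_derivative_transform_within_open[OF F1[OF x] this x eq]
  have "F1' x / x = F2' x / x" using DERIV_unique F2[OF x] by blast
  moreover have "x \<noteq> 0" using x q by (auto simp: inner_annulus_def[OF q])
  ultimately show ?thesis by simp
qed

section \<open>The log-derivatives of f and h and their values at -1\<close>

abbreviation "\<phi> \<equiv> pole_series (sg q)"
abbreviation "\<psi> \<equiv> pole_series (rho q)"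

lemma pole_series_derivatives:
  assumes "norm q < norm x" "norm x < 1 / norm q" "x \<noteq> 1"
  shows "(\<phi> k has_field_derivative \<phi> (Suc k) x / x) (at x)"
    and "(\<psi> k has_field_derivative \<psi> (Suc k) x / x) (at x)"
  using pole_series_derivative[OF q annular_tail(1)[OF q] assms]
    pole_series_derivative[OF q annular_tail(2)[OF q] assms] by auto

lemma inner_annulus_imp: "x \<in> inner_annulus q \<Longrightarrow> norm q < norm x \<and> norm x < 1 / norm q \<and> x \<noteq> 1 \<and> x \<noteq> 0"
proof -
  assume "x \<in> inner_annulus q"
  then have x: "norm q < norm x" "norm x < 1" by (simp_all add: inner_annulus_def[OF q])
  moreover have "norm x < 1 / norm q" by (rule less_trans[OF x(2)]) (use q in simp)
  ultimately show ?thesis using q by auto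
qed

lemma isCont_pole_series: "isCont (\<phi> k) (- 1)" "isCont (\<psi> k) (- 1)"
  using pole_series_derivatives[of "- 1" k] q by (auto intro: DERIV_isCont)

text \<open>At \<open>- 1\<close> the argument of the polynomial is \<open>1 / 2\<close>. For odd
  \<open>k\<close> both the weight \<open>n ^ k\<close> and the tail are odd, so the terms at
  \<open>m\<close> and \<open>- m\<close> coincide and give twice a Lambert summand.\<close>

lemma odd_pole_series_at_minus_one:
  assumes "odd k"
  shows "\<phi> k (- 1) = poly (pole_poly k) (1 / 2) + 2 * U k q"
    and "\<psi> k (- 1) = poly (pole_poly k) (1 / 2) + 2 * G k q"
proof -
  have k: "k > 0" using assms by (auto intro: Nat.gr0I)
  have s: "(\<lambda>n. of_int n ^ k * tail (sg q) n * (- 1) powi n) summable_on UNIV"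
    "(\<lambda>n. of_int n ^ k * tail (rho q) n * (- 1) powi n) summable_on UNIV"
    by (rule annularD annular_times_index_power annular_tail q | use q in simp)+
  have "laurent_sum (\<lambda>n. of_int n ^ k * tail (sg q) n) (- 1) =
      (\<Sum>\<^sub>\<infinity>r\<in>{1..}. 2 * ((- 1) ^ (r - 1) * (of_nat r ^ k * q ^ r / (1 + q ^ r))))"
    unfolding laurent_sum_def infsum_int_pairs[OF s(1)]
  proof (subst add_0[symmetric], intro arg_cong2[where f = "(+)"] infsum_cong)
    fix m :: nat assume "m \<in> {1..}"
    then obtain i where m: "m = Suc i" by (cases m) auto
    show "of_int (int m) ^ k * tail (sg q) (int m) * (- 1) powi int m
         + of_int (- int m) ^ k * tail (sg q) (- int m) * (- 1) powi (- int m) =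
       2 * ((- 1) ^ (m - 1) * (of_nat m ^ k * q ^ m / (1 + q ^ m)))"
      using tail_pos(1)[OF q, of m] tail_neg(1)[OF q, of m] assms
      by (simp add: m power_int_minus_one_minus del: of_nat_Suc int_Suc)
  qed (use k in simp)
  then show "\<phi> k (- 1) = poly (pole_poly k) (1 / 2) + 2 * U k q"
    by (simp only: pole_series_def U_def infsum_cmult_right') simp
  have "laurent_sum (\<lambda>n. of_int n ^ k * tail (rho q) n) (- 1) =
      (\<Sum>\<^sub>\<infinity>r\<in>{1..}. 2 * ((- 1) ^ r * (of_nat r ^ k * q ^ r / (1 - q ^ r))))"
    unfolding laurent_sum_def infsum_int_pairs[OF s(2)]
  proof (subst add_0[symmetric], intro arg_cong2[where f = "(+)"] infsum_cong)
    fix m :: nat assume "m \<in> {1..}"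
    then show "of_int (int m) ^ k * tail (rho q) (int m) * (- 1) powi int m
         + of_int (- int m) ^ k * tail (rho q) (- int m) * (- 1) powi (- int m) =
       2 * ((- 1) ^ m * (of_nat m ^ k * q ^ m / (1 - q ^ m)))"
      using tail_pos(2)[OF q, of m] tail_neg(2)[OF q, of m] assms
      by (simp add: power_int_minus_one_minus)
  qed (use k in simp)
  then show "\<psi> k (- 1) = poly (pole_poly k) (1 / 2) + 2 * G k q"
    by (simp only: pole_series_def G_def infsum_cmult_right') simp
qed

text \<open>Without a weight the terms at \<open>m\<close> and \<open>- m\<close> cancel, and the
  term \<open>- 1 / 2\<close> at index 0 cancels the contribution \<open>1 / 2\<close> of the pole
  part.\<close>

lemma pole_series_zero_at_minus_one: "\<phi> 0 (- 1) = 0"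
proof -
  have s: "(\<lambda>n. tail (sg q) n * (- 1) powi n) summable_on UNIV"
    by (rule annularD annular_tail q | use q in simp)+
  have "laurent_sum (tail (sg q)) (- 1) =
     - 1 / 2 + (\<Sum>\<^sub>\<infinity>m\<in>{1..}. tail (sg q) (int m) * (- 1) powi int m + tail (sg q) (- int m) * (- 1) powi (- int m))"
    unfolding laurent_sum_def infsum_int_pairs[OF s] by (simp add: tail_zero[OF q])
  also have "(\<Sum>\<^sub>\<infinity>m\<in>{1..}. tail (sg q) (int m) * (- 1) powi int m + tail (sg q) (- int m) * (- 1) powi (- int m)) = 0"
    by (rule infsum_0)
       (simp add: tail_pos(1)[OF q] tail_neg(1)[OF q] power_int_minus flip: power_inverse)
  finally show ?thesis by (simp add: pole_series_def)
qed

text \<open>These are the Abel sums of the divergent series with terms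
  \<open>(- 1) ^ n * n ^ k\<close>, that is, the negatives of the Dirichlet eta values at
  \<open>- k\<close>.\<close>

lemma pole_poly_values:
  "poly (pole_poly 1) (1 / 2) = - 1 / 4" "poly (pole_poly 3) (1 / 2) = 1 / 8"
  "poly (pole_poly 5) (1 / 2) = - 1 / 4" "poly (pole_poly 7) (1 / 2) = 17 / 16"
  by (simp_all add: eval_nat_numeral pderiv_pCons pderiv_mult)

text \<open>Here \<open>\<phi> k\<close> is the k-th log-derivative of f and
  \<open>\<psi> (Suc k)\<close> the k-th of h. The relations f^2 = c + h and f'' = 2 f^3 + L f are
  differentiated in the annulus and taken to the boundary point \<open>- 1\<close>, where f and f''
  vanish, so that only odd derivatives of f remain.\<close>

lemma taylor_relations:
  "\<psi> 3 (- 1) = 2 * \<phi> 1 (- 1) ^ 2"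
  "\<psi> 5 (- 1) = 8 * \<phi> 1 (- 1) * \<phi> 3 (- 1)"
  "\<psi> 7 (- 1) = 20 * \<phi> 3 (- 1) ^ 2 + 12 * \<phi> 1 (- 1) * \<phi> 5 (- 1)"
  "\<phi> 1 (- 1) * \<phi> 5 (- 1) - \<phi> 3 (- 1) ^ 2 = 12 * \<phi> 1 (- 1) ^ 4"
proof -
  have D: "(\<phi> 0 has_field_derivative \<phi> 1 x / x) (at x)" "(\<phi> 1 has_field_derivative \<phi> 2 x / x) (at x)"
    "(\<phi> 2 has_field_derivative \<phi> 3 x / x) (at x)" "(\<phi> 3 has_field_derivative \<phi> 4 x / x) (at x)"
    "(\<phi> 4 has_field_derivative \<phi> 5 x / x) (at x)" "(\<phi> 5 has_field_derivative \<phi> 6 x / x) (at x)"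
    "(\<psi> 1 has_field_derivative \<psi> 2 x / x) (at x)"
    "(\<psi> 2 has_field_derivative \<psi> 3 x / x) (at x)" "(\<psi> 3 has_field_derivative \<psi> 4 x / x) (at x)"
    "(\<psi> 4 has_field_derivative \<psi> 5 x / x) (at x)" "(\<psi> 5 has_field_derivative \<psi> 6 x / x) (at x)"
    "(\<psi> 6 has_field_derivative \<psi> 7 x / x) (at x)" if "x \<in> inner_annulus q" for x
    using pole_series_derivatives[of x] inner_annulus_imp[OF that] by (auto simp: eval_nat_numeral)
  have D': "(\<phi> 0 has_field_derivative \<phi> 1 x / x) (at x within S)" "(\<phi> 1 has_field_derivative \<phi> 2 x / x) (at x within S)"
    "(\<phi> 2 has_field_derivative \<phi> 3 x / x) (at x within S)" "(\<phi> 3 has_field_derivative \<phi> 4 x / x) (at x within S)"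
    "(\<phi> 4 has_field_derivative \<phi> 5 x / x) (at x within S)" "(\<phi> 5 has_field_derivative \<phi> 6 x / x) (at x within S)"
    if "x \<in> inner_annulus q" for x S
    using D[OF that] has_field_derivative_at_within by blast+
  obtain c where I0: "\<And>x. x \<in> inner_annulus q \<Longrightarrow> \<phi> 0 x ^ 2 = c + \<psi> 1 x"
    using pole_series_sg_square[OF q] by blast
  obtain K where J: "\<And>x. x \<in> inner_annulus q \<Longrightarrow> \<psi> 1 x * \<phi> 0 x = K * \<phi> 0 x + \<phi> 2 x / 2"
    using pole_series_product[OF q] by blast
  \<comment> \<open>Substituting h = f^2 - c into h f = K f + f''/2 gives f'' = 2 f^3 - 2 (c + K)
    f.\<close>
  define L where "L = - 2 * c - 2 * K"
  have J0: "\<phi> 2 x = 2 * \<phi> 0 x ^ 3 + L * \<phi> 0 x" if "x \<in> inner_annulus q" for x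
  proof -
    have "(\<phi> 0 x ^ 2 - c) * \<phi> 0 x = K * \<phi> 0 x + \<phi> 2 x / 2"
      using I0[OF that] J[OF that] by simp
    then show ?thesis by (simp add: L_def algebra_simps power2_eq_square power3_eq_cube)
  qed
  have J1: "\<phi> 3 x = 6 * \<phi> 0 x ^ 2 * \<phi> 1 x + L * \<phi> 1 x" if "x \<in> inner_annulus q" for x
    using J0 D(3) _ that
  proof (rule inner_annulus_derivative_unique)
    fix x assume x: "x \<in> inner_annulus q"
    show "((\<lambda>x. 2 * \<phi> 0 x ^ 3 + L * \<phi> 0 x) has_field_derivative (6 * \<phi> 0 x ^ 2 * \<phi> 1 x + L * \<phi> 1 x) / x) (at x)"
      by (rule derivative_eq_intros D'[OF x] refl)+ (use inner_annulus_imp[OF x] in \<open>simp add: field_simps power2_eq_square\<close>)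
  qed
  have J2: "\<phi> 4 x = 12 * \<phi> 0 x * \<phi> 1 x ^ 2 + 6 * \<phi> 0 x ^ 2 * \<phi> 2 x + L * \<phi> 2 x" if "x \<in> inner_annulus q" for x
    using J1 D(4) _ that
  proof (rule inner_annulus_derivative_unique)
    fix x assume x: "x \<in> inner_annulus q"
    show "((\<lambda>x. 6 * \<phi> 0 x ^ 2 * \<phi> 1 x + L * \<phi> 1 x) has_field_derivative
        (12 * \<phi> 0 x * \<phi> 1 x ^ 2 + 6 * \<phi> 0 x ^ 2 * \<phi> 2 x + L * \<phi> 2 x) / x) (at x)"
      by (rule derivative_eq_intros D'[OF x] refl)+ (use inner_annulus_imp[OF x] in \<open>simp add: field_simps power2_eq_square\<close>)
  qed
  have J3: "\<phi> 5 x = 12 * \<phi> 1 x ^ 3 + 36 * \<phi> 0 x * \<phi> 1 x * \<phi> 2 x + 6 * \<phi> 0 x ^ 2 * \<phi> 3 x + L * \<phi> 3 x"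
    if "x \<in> inner_annulus q" for x
    using J2 D(5) _ that
  proof (rule inner_annulus_derivative_unique)
    fix x assume x: "x \<in> inner_annulus q"
    show "((\<lambda>x. 12 * \<phi> 0 x * \<phi> 1 x ^ 2 + 6 * \<phi> 0 x ^ 2 * \<phi> 2 x + L * \<phi> 2 x) has_field_derivative
        (12 * \<phi> 1 x ^ 3 + 36 * \<phi> 0 x * \<phi> 1 x * \<phi> 2 x + 6 * \<phi> 0 x ^ 2 * \<phi> 3 x + L * \<phi> 3 x) / x) (at x)"
      by (rule derivative_eq_intros D'[OF x] refl)+
         (use inner_annulus_imp[OF x] in \<open>simp add: field_simps power2_eq_square power3_eq_cube\<close>)
  qed
  \<comment> \<open>From here on, the successive log-derivatives of f^2 = c + h, with equal terms of
    the Leibniz rule merged.\<close>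
  have I1: "2 * (\<phi> 0 x * \<phi> 1 x) = \<psi> 2 x" if "x \<in> inner_annulus q" for x
    using I0 _ _ that
  proof (rule inner_annulus_derivative_unique)
    fix x assume x: "x \<in> inner_annulus q"
    show "((\<lambda>x. \<phi> 0 x ^ 2) has_field_derivative (2 * (\<phi> 0 x * \<phi> 1 x)) / x) (at x)"
      by (rule derivative_eq_intros D'[OF x] refl)+ (use inner_annulus_imp[OF x] in \<open>simp add: field_simps power2_eq_square\<close>)
    show "((\<lambda>x. c + \<psi> 1 x) has_field_derivative \<psi> 2 x / x) (at x)"
      by (rule derivative_eq_intros D(7)[OF x] refl)+ simp
  qed
  have I2: "2 * (\<phi> 1 x ^ 2 + \<phi> 0 x * \<phi> 2 x) = \<psi> 3 x" if "x \<in> inner_annulus q" for x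
    using I1 _ D(8) that
  proof (rule inner_annulus_derivative_unique)
    fix x assume x: "x \<in> inner_annulus q"
    show "((\<lambda>x. 2 * (\<phi> 0 x * \<phi> 1 x)) has_field_derivative (2 * (\<phi> 1 x ^ 2 + \<phi> 0 x * \<phi> 2 x)) / x) (at x)"
      by (rule derivative_eq_intros D'[OF x] refl)+ (use inner_annulus_imp[OF x] in \<open>simp add: field_simps power2_eq_square\<close>)
  qed
  have I3: "2 * (3 * \<phi> 1 x * \<phi> 2 x + \<phi> 0 x * \<phi> 3 x) = \<psi> 4 x" if "x \<in> inner_annulus q" for x
    using I2 _ D(9) that
  proof (rule inner_annulus_derivative_unique)
    fix x assume x: "x \<in> inner_annulus q"
    show "((\<lambda>x. 2 * (\<phi> 1 x ^ 2 + \<phi> 0 x * \<phi> 2 x)) has_field_derivative (2 * (3 * \<phi> 1 x * \<phi> 2 x + \<phi> 0 x * \<phi> 3 x)) / x) (at x)"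
      by (rule derivative_eq_intros D'[OF x] refl)+ (use inner_annulus_imp[OF x] in \<open>simp add: field_simps power2_eq_square\<close>)
  qed
  have I4: "2 * (3 * \<phi> 2 x ^ 2 + 4 * \<phi> 1 x * \<phi> 3 x + \<phi> 0 x * \<phi> 4 x) = \<psi> 5 x" if "x \<in> inner_annulus q" for x
    using I3 _ D(10) that
  proof (rule inner_annulus_derivative_unique)
    fix x assume x: "x \<in> inner_annulus q"
    show "((\<lambda>x. 2 * (3 * \<phi> 1 x * \<phi> 2 x + \<phi> 0 x * \<phi> 3 x)) has_field_derivative
       (2 * (3 * \<phi> 2 x ^ 2 + 4 * \<phi> 1 x * \<phi> 3 x + \<phi> 0 x * \<phi> 4 x)) / x) (at x)"
      by (rule derivative_eq_intros D'[OF x] refl)+ (use inner_annulus_imp[OF x] in \<open>simp add: field_simps power2_eq_square\<close>)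
  qed
  have I5: "2 * (10 * \<phi> 2 x * \<phi> 3 x + 5 * \<phi> 1 x * \<phi> 4 x + \<phi> 0 x * \<phi> 5 x) = \<psi> 6 x" if "x \<in> inner_annulus q" for x
    using I4 _ D(11) that
  proof (rule inner_annulus_derivative_unique)
    fix x assume x: "x \<in> inner_annulus q"
    show "((\<lambda>x. 2 * (3 * \<phi> 2 x ^ 2 + 4 * \<phi> 1 x * \<phi> 3 x + \<phi> 0 x * \<phi> 4 x)) has_field_derivative
       (2 * (10 * \<phi> 2 x * \<phi> 3 x + 5 * \<phi> 1 x * \<phi> 4 x + \<phi> 0 x * \<phi> 5 x)) / x) (at x)"
      by (rule derivative_eq_intros D'[OF x] refl)+ (use inner_annulus_imp[OF x] in \<open>simp add: field_simps power2_eq_square\<close>)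
  qed
  have I6: "2 * (10 * \<phi> 3 x ^ 2 + 15 * \<phi> 2 x * \<phi> 4 x + 6 * \<phi> 1 x * \<phi> 5 x + \<phi> 0 x * \<phi> 6 x) = \<psi> 7 x" if "x \<in> inner_annulus q" for x
    using I5 _ D(12) that
  proof (rule inner_annulus_derivative_unique)
    fix x assume x: "x \<in> inner_annulus q"
    show "((\<lambda>x. 2 * (10 * \<phi> 2 x * \<phi> 3 x + 5 * \<phi> 1 x * \<phi> 4 x + \<phi> 0 x * \<phi> 5 x)) has_field_derivative
       (2 * (10 * \<phi> 3 x ^ 2 + 15 * \<phi> 2 x * \<phi> 4 x + 6 * \<phi> 1 x * \<phi> 5 x + \<phi> 0 x * \<phi> 6 x)) / x) (at x)"
      by (rule derivative_eq_intros D'[OF x] refl)+ (use inner_annulus_imp[OF x] in \<open>simp add: field_simps power2_eq_square\<close>)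
  qed
  note z = pole_series_zero_at_minus_one
  have cont: "isCont (\<lambda>x. \<phi> k x) (- 1)" "isCont (\<lambda>x. \<psi> k x) (- 1)" for k
    using isCont_pole_series by auto
  \<comment> \<open>Both terms of the cubic contain f, so f'' vanishes together with f. This also
    removes the products with \<open>\<phi> 4\<close> below.\<close>
  have z2: "\<phi> 2 (- 1) = 0"
    using inner_annulus_boundary_unique[of "\<lambda>x. \<phi> 2 x" "\<lambda>x. 2 * \<phi> 0 x ^ 3 + L * \<phi> 0 x" "- 1", OF J0] z by (simp add: cont)
  have f3: "\<phi> 3 (- 1) = L * \<phi> 1 (- 1)"
    using inner_annulus_boundary_unique[of "\<lambda>x. \<phi> 3 x" "\<lambda>x. 6 * \<phi> 0 x ^ 2 * \<phi> 1 x + L * \<phi> 1 x" "- 1", OF J1] z by (simp add: cont)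
  have f5: "\<phi> 5 (- 1) = 12 * \<phi> 1 (- 1) ^ 3 + L * \<phi> 3 (- 1)"
    using inner_annulus_boundary_unique[of "\<lambda>x. \<phi> 5 x" "\<lambda>x. 12 * \<phi> 1 x ^ 3 + 36 * \<phi> 0 x * \<phi> 1 x * \<phi> 2 x + 6 * \<phi> 0 x ^ 2 * \<phi> 3 x + L * \<phi> 3 x" "- 1", OF J3] z z2 by (simp add: cont)
  \<comment> \<open>The unknown \<open>L\<close> drops out: the left side is
    \<open>12 * \<phi> 1 ^ 4 + \<phi> 3 * (L * \<phi> 1 - \<phi> 3)\<close>, all at
    \<open>- 1\<close>, and the bracket is 0.\<close>
  show "\<phi> 1 (- 1) * \<phi> 5 (- 1) - \<phi> 3 (- 1) ^ 2 = 12 * \<phi> 1 (- 1) ^ 4"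
    by (simp add: f5 f3 algebra_simps power2_eq_square power3_eq_cube power4_eq_xxxx)
  show "\<psi> 3 (- 1) = 2 * \<phi> 1 (- 1) ^ 2"
    using inner_annulus_boundary_unique[of "\<lambda>x. 2 * (\<phi> 1 x ^ 2 + \<phi> 0 x * \<phi> 2 x)" "\<lambda>x. \<psi> 3 x" "- 1", OF I2] z by (simp add: cont)
  show "\<psi> 5 (- 1) = 8 * \<phi> 1 (- 1) * \<phi> 3 (- 1)"
    using inner_annulus_boundary_unique[of "\<lambda>x. 2 * (3 * \<phi> 2 x ^ 2 + 4 * \<phi> 1 x * \<phi> 3 x + \<phi> 0 x * \<phi> 4 x)" "\<lambda>x. \<psi> 5 x" "- 1", OF I4] z z2 by (auto simp: cont mult.assoc)
  show "\<psi> 7 (- 1) = 20 * \<phi> 3 (- 1) ^ 2 + 12 * \<phi> 1 (- 1) * \<phi> 5 (- 1)"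
    using inner_annulus_boundary_unique[of "\<lambda>x. 2 * (10 * \<phi> 3 x ^ 2 + 15 * \<phi> 2 x * \<phi> 4 x + 6 * \<phi> 1 x * \<phi> 5 x + \<phi> 0 x * \<phi> 6 x)" "\<lambda>x. \<psi> 7 x" "- 1", OF I6] z z2 by (auto simp: cont mult.assoc)
qed

text \<open>The Taylor relations with denominators cleared: the factors
  \<open>1 - 8 * U 1 q\<close>, \<open>1 + 16 * U 3 q\<close> and \<open>1 - 8 * U 5 q\<close> are
  \<open>- 4\<close>, \<open>8\<close> and \<open>- 4\<close> times the first, third and fifth
  log-derivative of f at \<open>- 1\<close>.\<close>

lemma lambert_series_relations:
  "1 + 16 * G 3 q = (1 - 8 * U 1 q) ^ 2"
  "1 - 8 * G 5 q = (1 - 8 * U 1 q) * (1 + 16 * U 3 q)"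
  "17 + 32 * G 7 q = 12 * (1 - 8 * U 1 q) * (1 - 8 * U 5 q) + 5 * (1 + 16 * U 3 q) ^ 2"
  "4 * (1 - 8 * U 1 q) * (1 - 8 * U 5 q) - (1 + 16 * U 3 q) ^ 2 = 3 * (1 - 8 * U 1 q) ^ 4"
proof -
  have v: "\<phi> 1 (- 1) = - (1 - 8 * U 1 q) / 4" "\<phi> 3 (- 1) = (1 + 16 * U 3 q) / 8"
    "\<phi> 5 (- 1) = - (1 - 8 * U 5 q) / 4" "\<psi> 3 (- 1) = (1 + 16 * G 3 q) / 8"
    "\<psi> 5 (- 1) = - (1 - 8 * G 5 q) / 4" "\<psi> 7 (- 1) = (17 + 32 * G 7 q) / 16"
    using pole_poly_values by (simp_all add: odd_pole_series_at_minus_one field_simps)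
  define A B C where "A = 1 - 8 * U 1 q" and "B = 1 + 16 * U 3 q" and "C = 1 - 8 * U 5 q"
  note t = taylor_relations[unfolded v, folded A_def B_def C_def]
  have "1 + 16 * G 3 q = 8 * ((1 + 16 * G 3 q) / 8)" by simp
  also have "\<dots> = A ^ 2" unfolding t(1) by (simp add: field_simps power2_eq_square)
  finally show "1 + 16 * G 3 q = (1 - 8 * U 1 q) ^ 2" by (simp add: A_def)
  have "1 - 8 * G 5 q = - 4 * (- (1 - 8 * G 5 q) / 4)" by simp
  also have "\<dots> = A * B" unfolding t(2) by (simp add: field_simps)
  finally show "1 - 8 * G 5 q = (1 - 8 * U 1 q) * (1 + 16 * U 3 q)" by (simp add: A_def B_def)
  have "17 + 32 * G 7 q = 16 * ((17 + 32 * G 7 q) / 16)" by simp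
  also have "\<dots> = 12 * A * C + 5 * B ^ 2" unfolding t(3) by (simp add: field_simps power2_eq_square)
  finally show "17 + 32 * G 7 q = 12 * (1 - 8 * U 1 q) * (1 - 8 * U 5 q) + 5 * (1 + 16 * U 3 q) ^ 2"
    by (simp add: A_def B_def C_def)
  have "4 * A * C - B ^ 2 = 64 * (- A / 4 * (- C / 4) - (B / 8) ^ 2)"
    by (simp add: field_simps power2_eq_square)
  also have "\<dots> = 3 * A ^ 4" unfolding t(4) by (simp add: power_divide)
  finally show "4 * (1 - 8 * U 1 q) * (1 - 8 * U 5 q) - (1 + 16 * U 3 q) ^ 2 = 3 * (1 - 8 * U 1 q) ^ 4"
    by (simp add: A_def B_def C_def)
qed

end

section \<open>Theta constants\<close>

lemma infsum_int_antisymmetric: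
  fixes f :: "int \<Rightarrow> complex"
  assumes "\<And>n. f (c - n) = - f n"
  shows "infsum f UNIV = 0"
proof -
  have "infsum f UNIV = - infsum f UNIV"
    using infsum_int_reflect(1)[of f c] by (simp add: assms infsum_uminus)
  then show ?thesis by simp
qed

section \<open>Triangular exponents\<close>

definition tri :: "int \<Rightarrow> int" where "tri n = n * (n - 1) div 2"

lemma two_tri: "2 * tri n = n * (n - 1)"
  by (simp add: tri_def)

text \<open>Supplies the geometric decay of the theta series. The bound reduces to
  \<open>(n - 1) * (n - 2) \<ge> 0\<close> for nonnegative \<open>n\<close> and to
  \<open>n * (n + 1) \<ge> 0\<close> for negative \<open>n\<close>.\<close>

lemma tri_ge: "\<bar>n\<bar> \<le> tri n + 1"
proof -
  have "2 * \<bar>n\<bar> \<le> n * (n - 1) + 2"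
  proof (cases "n \<ge> 0")
    case True
    have "0 \<le> (n - 1) * (n - 2)" by (cases "n \<ge> 2") (auto intro: mult_nonneg_nonneg mult_nonpos_nonpos)
    then show ?thesis using True by (simp add: algebra_simps)
  next
    case False
    have "0 \<le> n * (n + 1)" using False by (intro mult_nonpos_nonpos) auto
    then show ?thesis using False by (simp add: algebra_simps)
  qed
  then show ?thesis unfolding two_tri[symmetric] by linarith
qed

lemma tri_nonneg: "0 \<le> tri n"
  using tri_ge[of n] by (cases "n = 0") (auto simp: tri_def)

lemma tri_add_1: "tri (n + 1) = tri n + n"
proof -
  have "2 * tri (n + 1) = 2 * (tri n + n)" by (simp add: two_tri distrib_left) (simp add: algebra_simps)
  then show ?thesis by simp
qed

text \<open>Every exponent thus occurs twice, at \<open>n\<close> and at \<open>1 - n\<close>; in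
  the alternating series the two occurrences cancel.\<close>

lemma tri_reflect: "tri (1 - n) = tri n"
proof -
  have "2 * tri (1 - n) = 2 * tri n" unfolding two_tri by (simp add: algebra_simps)
  then show ?thesis by simp
qed

lemma tri_eq_0_iff: "tri n = 0 \<longleftrightarrow> n \<in> {0, 1}"
  using two_tri[of n] by auto

text \<open>The variables \<open>N + j\<close> and \<open>N - j\<close> diagonalise the sum of two
  exponents, which separates a product of theta series into products of series in q and q^2.\<close>

lemma tri_sum_even: "tri (N + j) + tri (N - j) = 2 * tri N + j ^ 2"
proof -
  have "2 * (tri (N + j) + tri (N - j)) = 2 * (2 * tri N + j ^ 2)"
    unfolding distrib_left two_tri by (simp add: algebra_simps power2_eq_square)
  then show ?thesis by simp
qed

lemma tri_sum_odd: "tri (N + 1 + j) + tri (N - j) = N ^ 2 + 2 * tri (j + 1)"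
proof -
  have "2 * (tri (N + 1 + j) + tri (N - j)) = 2 * (N ^ 2 + 2 * tri (j + 1))"
    unfolding distrib_left two_tri by (simp add: algebra_simps power2_eq_square)
  then show ?thesis by simp
qed

lemma sq_ge: "\<bar>n\<bar> \<le> n ^ 2 + (1 :: int)"
  using zero_le_power2[of "\<bar>n\<bar> - 1"] by (simp add: power2_diff)

text \<open>Pairs with even coordinate sum are uniquely \<open>(N + j, N - j)\<close>, those with
  odd sum \<open>(N + 1 + j, N - j)\<close>: the two cosets of an index-two sublattice.\<close>

lemma infsum_product_parity_split:
  fixes a b :: "int \<Rightarrow> complex"
  assumes a: "a summable_on UNIV" and b: "b summable_on UNIV"
  shows "infsum a UNIV * infsum b UNIV =
    (\<Sum>\<^sub>\<infinity>(N, j)\<in>UNIV. a (N + j) * b (N - j)) + (\<Sum>\<^sub>\<infinity>(N, j)\<in>UNIV. a (N + 1 + j) * b (N - j))"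
proof -
  define F where "F = (\<lambda>(x, y). a x * b y)"
  have F: "(F has_sum (infsum a UNIV * infsum b UNIV)) UNIV"
    using has_sum_product_complex[OF a b] by (simp add: F_def)
  define A where "A = (\<lambda>(N :: int, j). (N + j, N - j))"
  define B where "B = (\<lambda>(N :: int, j). (N + 1 + j, N - j))"
  have inj: "inj A" "inj B" by (auto simp: A_def B_def inj_on_def)
  have "(x, y) \<in> range A \<union> range B" for x y
  proof (cases "even (x + y)")
    case True
    then obtain k where "x + y = 2 * k" by (elim evenE)
    then have "(x, y) = A (k, x - k)" by (simp add: A_def)
    then show ?thesis by blast
  next
    case False
    then obtain k where "x + y = 2 * k + 1" by (elim oddE)
    then have "(x, y) = B (k, x - k - 1)" by (simp add: B_def)
    then show ?thesis by blast
  qed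
  then have cover: "UNIV = range A \<union> range B" by auto
  have "range A \<subseteq> {p. even (fst p + snd p)}" "range B \<subseteq> {p. odd (fst p + snd p)}"
    by (auto simp: A_def B_def)
  then have disj: "range A \<inter> range B = {}" by blast
  have s: "F summable_on range A" "F summable_on range B"
    using summable_on_subset[OF has_sum_imp_summable[OF F]] by auto
  have "infsum a UNIV * infsum b UNIV = infsum F UNIV" using F by (simp add: has_sum_iff)
  also have "\<dots> = infsum F (range A \<union> range B)" by (rule arg_cong[OF cover])
  also have "\<dots> = infsum F (range A) + infsum F (range B)" by (rule infsum_Un_disjoint[OF s disj])
  also have "\<dots> = infsum (F \<circ> A) UNIV + infsum (F \<circ> B) UNIV"
    by (simp add: infsum_reindex inj)
  finally show ?thesis by (simp add: F_def A_def B_def o_def case_prod_unfold)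
qed

lemma infsum_product:
  fixes a b :: "int \<Rightarrow> complex"
  assumes "a summable_on UNIV" and "b summable_on UNIV"
  shows "(\<Sum>\<^sub>\<infinity>(N, j)\<in>UNIV. a N * b j) = infsum a UNIV * infsum b UNIV"
    and "(\<lambda>(N, j). a N * b j) summable_on UNIV"
  using has_sum_product_complex[OF assms] by (simp_all add: has_sum_iff)

section \<open>Convergence and limits of theta series\<close>

lemma theta_annular:
  fixes q :: complex
  assumes q: "0 < norm q" "norm q < 1" and e: "\<And>n. \<bar>n\<bar> \<le> e n + 1" and s: "\<And>n. norm (s n) \<le> 1"
  shows "annular (norm q) (\<lambda>n. s n * q powi e n)"
proof (rule annular_geometricI[OF q(1)])
  fix n :: int
  have "norm (s n * q powi e n) \<le> 1 * norm q powi e n"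
    unfolding norm_mult norm_power_int by (intro mult_right_mono s) auto
  \<comment> \<open>The off-by-one in the lower bound for \<open>e n\<close> costs only the constant
    \<open>1 / norm q\<close>.\<close>
  also have "\<dots> \<le> norm q powi (\<bar>n\<bar> - 1)"
    using q e[of n] by (auto intro!: power_int_decreasing)
  also have "\<dots> = 1 / norm q * norm q ^ nat \<bar>n\<bar>"
    using q by (simp add: power_int_diff) (simp add: power_int_def)
  finally show "norm (s n * q powi e n) \<le> 1 / norm q * norm q ^ nat \<bar>n\<bar>" .
qed

lemma theta_summable:
  fixes q :: complex
  assumes q: "0 < norm q" "norm q < 1" and e: "\<And>n. \<bar>n\<bar> \<le> e n + 1" and s: "\<And>n. norm (s n) \<le> 1"
  shows "(\<lambda>n. of_int n ^ k * (s n * q powi e n)) summable_on UNIV"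
  using annularD[OF annular_times_index_power[OF q(1) theta_annular[OF q e s]], of 1 k] q by simp

text \<open>For \<open>norm (z i) < norm r\<close> each term of positive exponent is at most
  \<open>norm (z i) / norm r\<close> times the norm of the corresponding term at the fixed
  \<open>r\<close>. Hence only the terms of exponent 0 survive in the limit.\<close>

lemma theta_tendsto:
  fixes a :: "int \<Rightarrow> complex" and r :: complex
  assumes r: "r \<noteq> 0" and s: "(\<lambda>n. a n * r powi e n) summable_on UNIV"
    and e: "\<And>n. 0 \<le> e n" and fin: "finite {n. e n = 0}"
    and z: "z \<longlonglongrightarrow> 0" and z0: "\<And>i :: nat. z i \<noteq> 0"
  shows "(\<lambda>i. \<Sum>\<^sub>\<infinity>n. a n * z i powi e n) \<longlonglongrightarrow> (\<Sum>n | e n = 0. a n)"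
proof -
  define M where "M = (\<Sum>\<^sub>\<infinity>n. norm (a n * r powi e n))"
  have ns: "(\<lambda>n. norm (a n * r powi e n)) summable_on UNIV"
    by (rule iffD1[OF summable_on_iff_abs_summable_on_complex s])
  have small: "\<forall>\<^sub>F i in sequentially. norm (z i) < norm r"
    using tendsto_norm[OF z] r by (intro order_tendstoD(2)) auto
  have bound: "norm ((\<Sum>\<^sub>\<infinity>n. a n * z i powi e n) - (\<Sum>n | e n = 0. a n)) \<le> norm (z i) * (M / norm r)"
    if i: "norm (z i) < norm r" for i
  proof -
    have b: "norm (a n * z i powi e n) \<le> norm (z i) / norm r * norm (a n * r powi e n)" if n: "e n \<noteq> 0" for n
    proof -
      from e[of n] n obtain m where m: "e n = int (Suc m)"
        by (metis gr0_conv_Suc le_neq_trans of_nat_0_less_iff zero_le_imp_eq_int)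
      have "norm (z i) ^ m \<le> norm r ^ m" using i by (intro power_mono) auto
      then have "norm (a n) * (norm (z i) * norm (z i) ^ m) \<le> norm (a n) * (norm (z i) * norm r ^ m)"
        by (intro mult_left_mono) auto
      then show ?thesis using r by (simp add: m norm_mult norm_power mult_ac del: of_nat_Suc)
    qed
    have b': "norm (a n * z i powi e n) \<le> norm (a n * r powi e n)" for n
    proof (cases "e n = 0")
      case False
      have "norm (z i) / norm r * norm (a n * r powi e n) \<le> 1 * norm (a n * r powi e n)"
        using i by (intro mult_right_mono) (auto simp: divide_le_eq_1)
      then show ?thesis using b[OF False] by linarith
    qed simp
    have sz: "(\<lambda>n. a n * z i powi e n) summable_on UNIV"
      by (rule summable_on_complex_comparison[OF ns b'])
    let ?Z = "{n. e n = 0}"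
    have "infsum (\<lambda>n. a n * z i powi e n) (?Z \<union> - ?Z) =
        infsum (\<lambda>n. a n * z i powi e n) ?Z + infsum (\<lambda>n. a n * z i powi e n) (- ?Z)"
      by (rule infsum_Un_disjoint) (use fin summable_on_subset[OF sz] in auto)
    then have "(\<Sum>\<^sub>\<infinity>n. a n * z i powi e n) - (\<Sum>n\<in>?Z. a n) = infsum (\<lambda>n. a n * z i powi e n) (- ?Z)"
      using fin by (simp add: Compl_partition)
    also have "norm \<dots> \<le> infsum (\<lambda>n. norm (z i) / norm r * norm (a n * r powi e n)) (- ?Z)"
    proof (rule norm_infsum_le)
      show "((\<lambda>n. a n * z i powi e n) has_sum infsum (\<lambda>n. a n * z i powi e n) (- ?Z)) (- ?Z)"
        by (intro has_sum_infsum summable_on_subset[OF sz]) auto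
      show "((\<lambda>n. norm (z i) / norm r * norm (a n * r powi e n)) has_sum
         infsum (\<lambda>n. norm (z i) / norm r * norm (a n * r powi e n)) (- ?Z)) (- ?Z)"
        by (intro has_sum_infsum summable_on_cmult_right summable_on_subset[OF ns]) auto
    qed (use b in auto)
    also have "\<dots> = norm (z i) / norm r * infsum (\<lambda>n. norm (a n * r powi e n)) (- ?Z)"
      by (rule infsum_cmult_right')
    also have "\<dots> \<le> norm (z i) / norm r * M"
      unfolding M_def by (intro mult_left_mono infsum_mono_neutral summable_on_subset[OF ns] ns) auto
    finally show ?thesis by simp
  qed
  have "(\<lambda>i. norm (z i) * (M / norm r)) \<longlonglongrightarrow> 0"
    by (rule tendsto_mult_left_zero[OF tendsto_norm_zero[OF z]])
  then have "(\<lambda>i. (\<Sum>\<^sub>\<infinity>n. a n * z i powi e n) - (\<Sum>n | e n = 0. a n)) \<longlonglongrightarrow> 0"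
    by (rule Lim_null_comparison[rotated]) (use small bound in \<open>auto elim!: eventually_mono\<close>)
  then show ?thesis by (simp add: LIM_zero_iff)
qed

text \<open>The value \<Theta>(-1); up to a fractional power of q, Jacobi's constant theta-two at
  the square root of q.\<close>

definition tri_sum :: "complex \<Rightarrow> complex" where
  "tri_sum q = (\<Sum>\<^sub>\<infinity>n. q powi tri n)"

text \<open>The log-derivative of \<Theta> at 1; in Jacobi's product form, minus the cube of the
  Euler product of the factors 1 - q^n.\<close>

definition alt_tri_sum :: "complex \<Rightarrow> complex" where
  "alt_tri_sum q = (\<Sum>\<^sub>\<infinity>n. of_int n * ((- 1) powi n * q powi tri n))"

lemma theta3_null_minus: "theta3_null (- q) = (\<Sum>\<^sub>\<infinity>j. (- 1) powi j * q powi (j ^ 2))"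
proof -
  have "(- q) powi (j ^ 2) = (- 1) powi j * q powi (j ^ 2)" for j :: int
    by (cases "even j") simp_all
  then show ?thesis by (simp add: theta3_null_def)
qed

lemma norm_minus_one_powi: "norm ((- 1 :: complex) powi n) = 1"
  by (simp add: norm_power_int)

lemma minus_one_powi_add: "(- 1 :: complex) powi (m + n) = (- 1) powi m * (- 1) powi n"
  by (simp add: power_int_add)

context
  fixes q :: complex
  assumes q: "0 < norm q" "norm q < 1"
begin

lemma square_in_disc: "0 < norm (q\<^sup>2)" "norm (q\<^sup>2) < 1"
  using q by (auto simp: norm_power power_less_one_iff)

lemma powi_sq: "(q\<^sup>2) powi n = q powi (2 * n)"
  by (simp add: power_int_mult)

lemma q_powi_add: "q powi (m + n) = q powi m * q powi n"
  using q by (simp add: power_int_add)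

lemma theta_series_summable:
  "(\<lambda>n. q powi tri n) summable_on UNIV"
  "(\<lambda>n. (- 1) powi n * q powi tri n) summable_on UNIV"
  "(\<lambda>n. of_int n * ((- 1) powi n * q powi tri n)) summable_on UNIV"
  "(\<lambda>n. q powi n ^ 2) summable_on UNIV"
  "(\<lambda>n. (- 1) powi n * q powi n ^ 2) summable_on UNIV"
  "(\<lambda>n. of_int n * ((- 1) powi n * q powi n ^ 2)) summable_on UNIV"
  using theta_summable[OF q tri_ge, of "\<lambda>_. 1" 0] theta_summable[OF q tri_ge, of "\<lambda>n. (- 1) powi n" 0]
    theta_summable[OF q tri_ge, of "\<lambda>n. (- 1) powi n" 1]
    theta_summable[OF q sq_ge, of "\<lambda>_. 1" 0] theta_summable[OF q sq_ge, of "\<lambda>n. (- 1) powi n" 0]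
    theta_summable[OF q sq_ge, of "\<lambda>n. (- 1) powi n" 1]
  by (simp_all add: norm_minus_one_powi)

lemma infsum_alt_tri: "(\<Sum>\<^sub>\<infinity>n. (- 1) powi n * q powi tri n) = 0"
proof (rule infsum_int_antisymmetric[where c = 1])
  show "(- 1) powi (1 - n) * q powi tri (1 - n) = - ((- 1) powi n * q powi tri n)" for n
    using minus_one_powi_add[of 1 "- n"] by (simp add: tri_reflect power_int_minus_one_minus)
qed

lemma infsum_alt_square_index: "(\<Sum>\<^sub>\<infinity>n. of_int n * ((- 1) powi n * q powi n ^ 2)) = 0"
  by (rule infsum_int_antisymmetric[where c = 0]) (auto simp: power_int_minus_one_minus)

end

lemma has_sum_int_shift_1:
  fixes f :: "int \<Rightarrow> complex"
  assumes "f summable_on UNIV"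
  shows "(\<lambda>n. f (n + 1)) summable_on UNIV" "(\<Sum>\<^sub>\<infinity>n. f (n + 1)) = infsum f UNIV"
proof -
  have "((\<lambda>n. f (n + 1)) has_sum infsum f UNIV) UNIV"
    using assms by (subst has_sum_int_shift) simp
  then show "(\<lambda>n. f (n + 1)) summable_on UNIV" "(\<Sum>\<^sub>\<infinity>n. f (n + 1)) = infsum f UNIV"
    by (rule has_sum_imp_summable, rule infsumI)
qed

section \<open>Theta identities relating q and q^2\<close>

context
  fixes q :: complex
  assumes q: "0 < norm q" "norm q < 1"
begin

text \<open>Both halves of the parity split equal
  \<open>theta3_null q * tri_sum (q\<^sup>2)\<close>.\<close>

lemma tri_sum_square: "tri_sum q ^ 2 = 2 * theta3_null q * tri_sum (q\<^sup>2)"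
proof -
  note s = theta_series_summable[OF q] and s2 = theta_series_summable[OF square_in_disc[OF q]]
  have "tri_sum q ^ 2 = (\<Sum>\<^sub>\<infinity>(N, j)\<in>UNIV. q powi tri (N + j) * q powi tri (N - j)) +
      (\<Sum>\<^sub>\<infinity>(N, j)\<in>UNIV. q powi tri (N + 1 + j) * q powi tri (N - j))"
    unfolding power2_eq_square tri_sum_def by (rule infsum_product_parity_split[OF s(1) s(1)])
  also have "\<dots> = (\<Sum>\<^sub>\<infinity>(N, j)\<in>UNIV. (q\<^sup>2) powi tri N * q powi (j ^ 2)) +
      (\<Sum>\<^sub>\<infinity>(N, j)\<in>UNIV. q powi (N ^ 2) * (q\<^sup>2) powi tri (j + 1))"
  proof -
    have "q powi tri (N + j) * q powi tri (N - j) = (q\<^sup>2) powi tri N * q powi (j ^ 2)" for N j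
      by (simp only: q_powi_add[OF q, symmetric] powi_sq[OF q] tri_sum_even)
    moreover have "q powi tri (N + 1 + j) * q powi tri (N - j) = q powi (N ^ 2) * (q\<^sup>2) powi tri (j + 1)" for N j
      by (simp only: q_powi_add[OF q, symmetric] powi_sq[OF q] tri_sum_odd)
    ultimately show ?thesis
      by (intro arg_cong2[where f = "(+)"] infsum_cong) (simp_all only: case_prod_unfold)
  qed
  also have "\<dots> = tri_sum (q\<^sup>2) * theta3_null q + theta3_null q * tri_sum (q\<^sup>2)"
    using infsum_product(1)[OF s2(1) s(4)] infsum_product(1)[OF s(4) has_sum_int_shift_1(1)[OF s2(1)]]
      has_sum_int_shift_1(2)[OF s2(1)] by (simp only: tri_sum_def theta3_null_def)
  finally show ?thesis by simp
qed

text \<open>The even half of the parity split is the right-hand side. The odd half is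
  \<open>q\<close> times the square of an alternating triangular series, which is 0.\<close>

lemma theta_null_product: "theta3_null q * theta3_null (- q) = theta3_null (- q\<^sup>2) ^ 2"
proof -
  note s = theta_series_summable[OF q] and s2 = theta_series_summable[OF square_in_disc[OF q]]
    and s4 = theta_series_summable[OF square_in_disc[OF square_in_disc[OF q]]]
  define u where "u n = (- 1) powi n * ((q\<^sup>2)\<^sup>2) powi tri n" for n
  have u: "u summable_on UNIV" "infsum u UNIV = 0"
    using s4(2) infsum_alt_tri[OF square_in_disc[OF square_in_disc[OF q]]] by (simp_all add: u_def[abs_def])
  have odd: "q powi (N + 1 + j) ^ 2 * ((- 1) powi (N - j) * q powi (N - j) ^ 2) = q * (u (N + 1) * u (j + 1))" for N j
  proof -
    \<comment> \<open>Both sides equal 1 + 2 N (N + 1) + 2 j (j + 1), which accounts for the leading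
      factor \<open>q\<close> and the base q^4 in \<open>u\<close>.\<close>
    have e: "(N + 1 + j) ^ 2 + (N - j) ^ 2 = 1 + (2 * (2 * tri (N + 1)) + 2 * (2 * tri (j + 1)))"
      unfolding two_tri by (simp add: power2_eq_square algebra_simps)
    have "q powi (N + 1 + j) ^ 2 * q powi (N - j) ^ 2 =
        q powi 1 * (((q\<^sup>2)\<^sup>2) powi tri (N + 1) * ((q\<^sup>2)\<^sup>2) powi tri (j + 1))"
      by (simp only: powi_sq[OF square_in_disc[OF q]] powi_sq[OF q] q_powi_add[OF q, symmetric] e)
    moreover have "(- 1 :: complex) powi (N - j) = (- 1) powi (N + 1) * (- 1) powi (j + 1)"
      using minus_one_powi_add[of N "- j"] by (simp add: minus_one_powi_add power_int_minus_one_minus)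
    ultimately show ?thesis by (simp add: u_def mult_ac)
  qed
  have even: "q powi (N + j) ^ 2 * ((- 1) powi (N - j) * q powi (N - j) ^ 2) =
      ((- 1) powi N * (q\<^sup>2) powi N ^ 2) * ((- 1) powi j * (q\<^sup>2) powi j ^ 2)" for N j
  proof -
    have e: "(N + j) ^ 2 + (N - j) ^ 2 = 2 * N ^ 2 + 2 * j ^ 2" by (simp add: power2_eq_square algebra_simps)
    have "q powi (N + j) ^ 2 * q powi (N - j) ^ 2 = (q\<^sup>2) powi N ^ 2 * (q\<^sup>2) powi j ^ 2"
      by (simp only: powi_sq[OF q] q_powi_add[OF q, symmetric] e)
    moreover have "(- 1 :: complex) powi (N - j) = (- 1) powi N * (- 1) powi j"
      using minus_one_powi_add[of N "- j"] by (simp add: power_int_minus_one_minus)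
    ultimately show ?thesis by (simp add: mult_ac)
  qed
  have "theta3_null q * theta3_null (- q) =
      (\<Sum>\<^sub>\<infinity>(N, j)\<in>UNIV. q powi (N + j) ^ 2 * ((- 1) powi (N - j) * q powi (N - j) ^ 2)) +
      (\<Sum>\<^sub>\<infinity>(N, j)\<in>UNIV. q powi (N + 1 + j) ^ 2 * ((- 1) powi (N - j) * q powi (N - j) ^ 2))"
    unfolding theta3_null_minus unfolding theta3_null_def by (rule infsum_product_parity_split[OF s(4) s(5)])
  also have "\<dots> = (\<Sum>\<^sub>\<infinity>(N, j)\<in>UNIV. ((- 1) powi N * (q\<^sup>2) powi N ^ 2) * ((- 1) powi j * (q\<^sup>2) powi j ^ 2)) +
      q * (\<Sum>\<^sub>\<infinity>(N, j)\<in>UNIV. u (N + 1) * u (j + 1))"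
    by (subst infsum_cmult_right'[symmetric], intro arg_cong2[where f = "(+)"] infsum_cong)
       (simp_all only: case_prod_unfold even odd)
  also have "\<dots> = theta3_null (- q\<^sup>2) * theta3_null (- q\<^sup>2) + q * (0 * 0)"
    using infsum_product(1)[OF s2(5) s2(5)] infsum_product(1)[OF has_sum_int_shift_1(1)[OF u(1)] has_sum_int_shift_1(1)[OF u(1)]]
    by (simp only: theta3_null_minus has_sum_int_shift_1(2)[OF u(1)] u(2))
  finally show ?thesis by (simp add: power2_eq_square)
qed

text \<open>The weight is the first index, \<open>N + j\<close> or \<open>N + 1 + j\<close>, so each
  half of the parity split is a sum of two products. Those with the weight on the square exponent
  contain \<open>t'\<close>, whose sum is 0 by oddness; the other two are equal.\<close>

lemma alt_tri_sum_product: "alt_tri_sum q * tri_sum q = 2 * theta3_null (- q) * alt_tri_sum (q\<^sup>2)"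
proof -
  note s = theta_series_summable[OF q] and s2 = theta_series_summable[OF square_in_disc[OF q]]
  define w where "w n = of_int n * ((- 1) powi n * (q\<^sup>2) powi tri n)" for n
  define p where "p n = (- 1) powi n * (q\<^sup>2) powi tri n" for n
  define t where "t n = (- 1) powi n * q powi n ^ 2" for n
  define t' where "t' n = of_int n * ((- 1) powi n * q powi n ^ 2)" for n
  have sums: "w summable_on UNIV" "p summable_on UNIV" "t summable_on UNIV" "t' summable_on UNIV"
    using s s2 by (simp_all add: w_def[abs_def] p_def[abs_def] t_def[abs_def] t'_def[abs_def])
  have vals: "infsum w UNIV = alt_tri_sum (q\<^sup>2)" "infsum t UNIV = theta3_null (- q)" "infsum t' UNIV = 0"
    using infsum_alt_square_index[OF q]
    by (simp_all add: w_def[abs_def] t_def[abs_def] t'_def[abs_def] alt_tri_sum_def theta3_null_minus)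
  have even: "of_int (N + j) * ((- 1) powi (N + j) * q powi tri (N + j)) * q powi tri (N - j) = w N * t j + p N * t' j" for N j
  proof -
    have "q powi tri (N + j) * q powi tri (N - j) = (q\<^sup>2) powi tri N * q powi (j ^ 2)"
      unfolding q_powi_add[OF q, symmetric] powi_sq[OF q] tri_sum_even by simp
    then have "of_int (N + j) * ((- 1) powi (N + j) * q powi tri (N + j)) * q powi tri (N - j) =
       of_int (N + j) * (((- 1) powi N * (- 1) powi j) * ((q\<^sup>2) powi tri N * q powi (j ^ 2)))"
      by (simp only: minus_one_powi_add mult.assoc)
    then show ?thesis by (simp add: w_def p_def t_def t'_def algebra_simps)
  qed
  have odd: "of_int (N + 1 + j) * ((- 1) powi (N + 1 + j) * q powi tri (N + 1 + j)) * q powi tri (N - j)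
     = t' N * p (j + 1) + t N * w (j + 1)" for N j
  proof -
    have "q powi tri (N + 1 + j) * q powi tri (N - j) = q powi (N ^ 2) * (q\<^sup>2) powi tri (j + 1)"
      unfolding q_powi_add[OF q, symmetric] powi_sq[OF q] tri_sum_odd by simp
    moreover have "(- 1 :: complex) powi (N + 1 + j) = (- 1) powi N * (- 1) powi (j + 1)"
      by (simp add: minus_one_powi_add)
    ultimately have "of_int (N + 1 + j) * ((- 1) powi (N + 1 + j) * q powi tri (N + 1 + j)) * q powi tri (N - j) =
       of_int (N + 1 + j) * (((- 1) powi N * (- 1) powi (j + 1)) * (q powi (N ^ 2) * (q\<^sup>2) powi tri (j + 1)))"
      by (simp only: mult.assoc)
    then show ?thesis by (simp add: w_def p_def t_def t'_def algebra_simps)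
  qed
  note sh = has_sum_int_shift_1[OF sums(1)] has_sum_int_shift_1[OF sums(2)]
  have "alt_tri_sum q * tri_sum q =
      (\<Sum>\<^sub>\<infinity>(N, j)\<in>UNIV. of_int (N + j) * ((- 1) powi (N + j) * q powi tri (N + j)) * q powi tri (N - j)) +
      (\<Sum>\<^sub>\<infinity>(N, j)\<in>UNIV. of_int (N + 1 + j) * ((- 1) powi (N + 1 + j) * q powi tri (N + 1 + j)) * q powi tri (N - j))"
    unfolding alt_tri_sum_def tri_sum_def by (rule infsum_product_parity_split[OF s(3) s(1)])
  also have "\<dots> = (infsum w UNIV * infsum t UNIV + infsum p UNIV * infsum t' UNIV) +
      (infsum t' UNIV * infsum p UNIV + infsum t UNIV * infsum w UNIV)"
    unfolding even odd
    using infsum_add[OF infsum_product(2)[OF sums(1,3)] infsum_product(2)[OF sums(2,4)]]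
      infsum_add[OF infsum_product(2)[OF sums(4) sh(3)] infsum_product(2)[OF sums(3) sh(1)]]
      infsum_product(1)[OF sums(1,3)] infsum_product(1)[OF sums(2,4)]
      infsum_product(1)[OF sums(4) sh(3)] infsum_product(1)[OF sums(3) sh(1)]
    by (simp add: case_prod_unfold sh)
  finally show ?thesis by (simp add: vals)
qed

section \<open>Repeated squaring: limits, nonvanishing and Jacobi's derivative formula\<close>

lemma iterated_square:
  fixes n :: nat
  shows "0 < norm (q ^ 2 ^ n)" "norm (q ^ 2 ^ n) < 1" "(q ^ 2 ^ n)\<^sup>2 = q ^ 2 ^ Suc n"
  using q by (auto simp: norm_power power_less_one_iff power_mult[symmetric] mult.commute)

lemma iterated_square_tendsto: "(\<lambda>n. q ^ 2 ^ n) \<longlonglongrightarrow> 0"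
proof (rule Lim_null_comparison)
  show "(\<lambda>n. norm q ^ n) \<longlonglongrightarrow> 0" using q by (intro LIMSEQ_power_zero) auto
  show "\<forall>\<^sub>F n in sequentially. norm (q ^ 2 ^ n) \<le> norm q ^ n"
    using q by (auto simp: norm_power less_imp_le intro!: always_eventually power_decreasing)
qed

text \<open>Only exponent 0 survives: indices 0 and 1 for the triangular exponents, contributing
  \<open>1 + 1\<close> and \<open>0 - 1\<close>, and index 0 for the squares.\<close>

lemma theta_limits:
  "(\<lambda>n. tri_sum (q ^ 2 ^ n)) \<longlonglongrightarrow> 2" "(\<lambda>n. alt_tri_sum (q ^ 2 ^ n)) \<longlonglongrightarrow> - 1"
  "(\<lambda>n. theta3_null (- (q ^ 2 ^ n))) \<longlonglongrightarrow> 1"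
proof -
  note s = theta_series_summable[OF q]
  have nz: "q \<noteq> 0" "q ^ 2 ^ n \<noteq> 0" for n :: nat using q by auto
  have Z: "{n. tri n = 0} = {0, 1}" "{n :: int. n ^ 2 = 0} = {0}" by (auto simp: tri_eq_0_iff)
  show "(\<lambda>n. tri_sum (q ^ 2 ^ n)) \<longlonglongrightarrow> 2"
    using theta_tendsto[OF nz(1), of "\<lambda>_. 1" tri, OF _ tri_nonneg _ iterated_square_tendsto nz(2)] s(1) Z
    by (simp add: tri_sum_def)
  show "(\<lambda>n. alt_tri_sum (q ^ 2 ^ n)) \<longlonglongrightarrow> - 1"
    using theta_tendsto[OF nz(1), of "\<lambda>n. of_int n * (- 1) powi n" tri, OF _ tri_nonneg _ iterated_square_tendsto nz(2)] s(3) Z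
    by (simp add: alt_tri_sum_def mult.assoc)
  show "(\<lambda>n. theta3_null (- (q ^ 2 ^ n))) \<longlonglongrightarrow> 1"
    using theta_tendsto[OF nz(1), of "\<lambda>n. (- 1) powi n" "\<lambda>n. n ^ 2", OF _ _ _ iterated_square_tendsto nz(2)] s(5) Z
    by (simp add: theta3_null_minus)
qed

end

text \<open>By the product identity a zero would propagate from \<open>- q\<close> to
  \<open>- q\<^sup>2\<close> and so along all iterated squares, against the limit 1.\<close>

lemma theta3_null_minus_nonzero:
  assumes q: "0 < norm q" "norm q < 1"
  shows "theta3_null (- q) \<noteq> 0"
proof
  assume *: "theta3_null (- q) = 0"
  have "theta3_null (- (q ^ 2 ^ n)) = 0" for n :: nat
  proof (induction n)
    case (Suc n)
    then show ?case
      using theta_null_product[OF iterated_square(1,2)[OF q], of n] by (simp only: iterated_square(3)[OF q]) simp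
  qed (simp add: *)
  then show False using theta_limits(3)[OF q] by (simp add: LIMSEQ_const_iff)
qed

lemma theta3_null_nonzero:
  assumes q: "0 < norm q" "norm q < 1"
  shows "theta3_null q \<noteq> 0"
  using theta_null_product[OF q] theta3_null_minus_nonzero[OF square_in_disc[OF q]] by auto

text \<open>A zero would again propagate under squaring, here after cancelling the nonzero factor
  \<open>theta3_null q\<close>, against the limit 2.\<close>

lemma tri_sum_nonzero:
  assumes q: "0 < norm q" "norm q < 1"
  shows "tri_sum q \<noteq> 0"
proof
  assume *: "tri_sum q = 0"
  have "tri_sum (q ^ 2 ^ n) = 0" for n :: nat
  proof (induction n)
    case (Suc n)
    then show ?case
      using tri_sum_square[OF iterated_square(1,2)[OF q], of n] theta3_null_nonzero[OF iterated_square(1,2)[OF q], of n]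
      by (simp only: iterated_square(3)[OF q]) simp
  qed (simp add: *)
  then show False using theta_limits(1)[OF q] by (simp add: LIMSEQ_const_iff)
qed

text \<open>The quotient of the two sides is invariant under \<open>q \<mapsto> q\<^sup>2\<close> and tends to 1 at the origin.\<close>

lemma jacobi_derivative_formula:
  assumes q: "0 < norm q" "norm q < 1"
  shows "2 * alt_tri_sum q = - (tri_sum q * theta3_null (- q) ^ 2)"
proof -
  define R where "R z = alt_tri_sum z / (tri_sum z * theta3_null (- z) ^ 2)" for z
  have step: "R z = R (z\<^sup>2)" if z: "0 < norm z" "norm z < 1" for z
  proof -
    note nz = tri_sum_nonzero[OF z] theta3_null_nonzero[OF z] theta3_null_minus_nonzero[OF z]
      tri_sum_nonzero[OF square_in_disc[OF z]]
    have "R z = (alt_tri_sum z * tri_sum z) / (tri_sum z ^ 2 * theta3_null (- z) ^ 2)"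
      using nz by (simp add: R_def power2_eq_square)
    also have "\<dots> = alt_tri_sum (z\<^sup>2) / (tri_sum (z\<^sup>2) * (theta3_null z * theta3_null (- z)))"
      unfolding alt_tri_sum_product[OF z] tri_sum_square[OF z] using nz by (simp add: power2_eq_square)
    finally show ?thesis by (simp add: theta_null_product[OF z] R_def)
  qed
  have "R (q ^ 2 ^ n) = R q" for n :: nat
  proof (induction n)
    case (Suc n)
    then show ?case
      using step[OF iterated_square(1,2)[OF q], of n] by (simp only: iterated_square(3)[OF q])
  qed simp
  moreover have "(\<lambda>n. R (q ^ 2 ^ n)) \<longlonglongrightarrow> - 1 / (2 * 1 ^ 2)"
    unfolding R_def by (intro tendsto_intros theta_limits[OF q]) auto
  ultimately have "R q = - 1 / 2" by (simp add: LIMSEQ_const_iff)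
  then show ?thesis
    using tri_sum_nonzero[OF q] theta3_null_minus_nonzero[OF q] by (simp add: R_def field_simps)
qed

section \<open>The sums of 16 and 24 squares\<close>

context
  fixes q :: complex
  assumes q: "0 < norm q" "norm q < 1"
begin

definition "theta_coeff n = (- 1) powi n * q powi tri n" for n

abbreviation "\<Theta> \<equiv> laurent_sum theta_coeff"
abbreviation "\<Theta>' \<equiv> laurent_sum (\<lambda>n. of_int n * theta_coeff n)"

lemma annular_theta_coeff: "annular (norm q) theta_coeff"
  unfolding theta_coeff_def[abs_def] by (rule theta_annular[OF q tri_ge]) (simp add: norm_minus_one_powi)

lemma theta_coeff_Suc: "theta_coeff (n + 1) = - (q powi n * theta_coeff n)"
  using q by (simp add: theta_coeff_def tri_add_1 power_int_add)

lemma infsum_theta_coeff: "theta_coeff summable_on UNIV" "infsum theta_coeff UNIV = 0"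
  using theta_series_summable(2)[OF q] infsum_alt_tri[OF q] by (simp_all add: theta_coeff_def[abs_def])

text \<open>Since 1 - 1/(1 + a) = a/(1 + a), one has
  \<open>q powi k * (1 - sg q (n - k)) = q powi n * sg q (n - k)\<close>. A shift of the summation
  index therefore yields the factor \<open>q powi n\<close> and an extra term
  \<open>theta_coeff (k + 1)\<close>, and the extra terms sum to 0.\<close>

lemma theta_sg_convolution_Suc:
  assumes s: "\<And>n. (\<lambda>k. theta_coeff k * sg q (n - k)) summable_on UNIV"
  shows "(\<Sum>\<^sub>\<infinity>k. theta_coeff k * sg q (n + 1 - k)) = q powi n * (\<Sum>\<^sub>\<infinity>k. theta_coeff k * sg q (n - k))"
proof -
  have step: "theta_coeff (k + 1) * sg q (n + 1 - (k + 1)) = theta_coeff (k + 1) + q powi n * (theta_coeff k * sg q (n - k))" for k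
  proof -
    have "q powi k * (1 - sg q (n - k)) = q powi n * sg q (n - k)"
    proof -
      have "q powi n = q powi k * q powi (n - k)" using q by (simp flip: power_int_add)
      moreover have "1 - sg q (n - k) = q powi (n - k) * sg q (n - k)"
        using one_plus_powi_nonzero[OF q, of "n - k"] by (simp add: sg_def field_simps)
      ultimately show ?thesis by simp
    qed
    then have "q powi n * (theta_coeff k * sg q (n - k)) = theta_coeff k * (q powi k * (1 - sg q (n - k)))"
      by simp
    also have "\<dots> = - theta_coeff (k + 1) * (1 - sg q (n - k))" unfolding theta_coeff_Suc by simp
    finally have "q powi n * (theta_coeff k * sg q (n - k)) = - theta_coeff (k + 1) * (1 - sg q (n - k))" .
    then show ?thesis by (simp add: algebra_simps)
  qed
  have "(\<Sum>\<^sub>\<infinity>k. theta_coeff k * sg q (n + 1 - k)) = (\<Sum>\<^sub>\<infinity>k. theta_coeff (k + 1) * sg q (n + 1 - (k + 1)))"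
    by (rule has_sum_int_shift_1(2)[OF s[of "n + 1"], symmetric])
  also have "\<dots> = (\<Sum>\<^sub>\<infinity>k. theta_coeff (k + 1) + q powi n * (theta_coeff k * sg q (n - k)))"
    by (simp only: step)
  also have "\<dots> =
      (\<Sum>\<^sub>\<infinity>k. theta_coeff (k + 1)) + q powi n * (\<Sum>\<^sub>\<infinity>k. theta_coeff k * sg q (n - k))"
    by (simp add: infsum_add has_sum_int_shift_1(1) infsum_theta_coeff(1) summable_on_cmult_right s infsum_cmult_right')
  finally show ?thesis by (simp add: has_sum_int_shift_1(2)[OF infsum_theta_coeff(1)] infsum_theta_coeff(2))
qed

text \<open>The coefficients \<open>X n\<close> of the product obey a first-order recurrence, so
  they equal \<open>X 0 * q powi tri n\<close>; these are the coefficients of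
  \<open>X 0 * \<Theta> (- x)\<close>, in which the signs cancel. The constant \<open>X 0\<close> is
  independent of \<open>x\<close>.\<close>

lemma pole_series_times_theta:
  obtains c where "\<And>x. x \<in> inner_annulus q \<Longrightarrow> pole_series (sg q) 0 x * \<Theta> x = c * \<Theta> (- x)"
proof
  define X where "X n = (\<Sum>\<^sub>\<infinity>k. theta_coeff k * sg q (n - k))" for n
  fix x assume xA: "x \<in> inner_annulus q"
  then have x: "norm q < norm x" "norm x < 1" "norm x < 1 / norm q" and x0: "x \<noteq> 0"
    using inner_annulus_imp[OF q xA] by (simp_all add: inner_annulus_def[OF q])
  have f: "((\<lambda>n. sg q n * x powi n) has_sum pole_series (sg q) 0 x) UNIV"
    using pole_series_has_sum[OF q annular_tail(1)[OF q] x(1,2), of 0] by simp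
  have t: "(\<lambda>n. theta_coeff n * x powi n) summable_on UNIV"
    using annularD[OF annular_theta_coeff x(1,3)] .
  have e: "theta_coeff k * x powi k * (sg q (n - k) * x powi (n - k)) = theta_coeff k * sg q (n - k) * x powi n" for n k
    using x0 by (simp flip: power_int_add)
  note conv = int_convolution[OF t has_sum_imp_summable[OF f], unfolded e]
  have s: "(\<lambda>k. theta_coeff k * sg q (n - k)) summable_on UNIV" for n
  proof -
    have "x powi n \<noteq> 0" using x0 by simp
    from iffD1[OF summable_on_cmult_left'[OF this] conv(1)] show ?thesis .
  qed
  have Suc: "X (n + 1) = q powi n * X n" for n
    unfolding X_def by (rule theta_sg_convolution_Suc[OF s])
  have X: "X n = X 0 * q powi tri n" for n
  proof (induction n rule: int_induct[where k = 0])
    case base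
    then show ?case by (simp add: tri_def)
  next
    case (step1 i)
    then show ?case
      by (simp only: Suc tri_add_1 q_powi_add[OF q]) simp
  next
    case (step2 i)
    \<comment> \<open>Going down, the recurrence is inverted by cancelling the nonzero factor
      \<open>q powi j\<close>.\<close>
    define j where "j = i - 1"
    have i: "i = j + 1" by (simp add: j_def)
    have "q powi j * X j = q powi j * (X 0 * q powi tri j)"
      using step2(2) by (simp only: i Suc tri_add_1 q_powi_add[OF q] mult_ac)
    then show ?case using q by (simp add: j_def)
  qed
  have eq: "X n * x powi n = X 0 * (theta_coeff n * (- x) powi n)" for n
  proof -
    have "(- x) powi n = (- 1) powi n * x powi n"
      using power_int_mult_distrib[of "- 1" x n] by simp
    then show ?thesis unfolding X[of n] theta_coeff_def by (simp add: mult_ac)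
  qed
  have "((\<lambda>n. X n * x powi n) has_sum (\<Theta> x * pole_series (sg q) 0 x)) UNIV"
    unfolding X_def infsum_cmult_left'[symmetric] unfolding laurent_sum_def using conv(2)[unfolded infsumI[OF f]] .
  then have "((\<lambda>n. X 0 * (theta_coeff n * (- x) powi n)) has_sum (\<Theta> x * pole_series (sg q) 0 x)) UNIV"
    by (rule has_sum_cong[THEN iffD1, rotated]) (rule eq)
  from infsumI[OF this] have "X 0 * \<Theta> (- x) = \<Theta> x * pole_series (sg q) 0 x"
    unfolding infsum_cmult_right' laurent_sum_def[of _ "- x", symmetric] .
  then show "pole_series (sg q) 0 x * \<Theta> x = X 0 * \<Theta> (- x)"
    by (metis mult.commute)
qed

text \<open>Both evaluations of the constant \<open>c\<close> come from differentiating
  \<open>f(x) \<Theta>(x) = c \<Theta>(-x)\<close>: at \<open>x = 1\<close> the pole of \<open>f\<close> meets the zero of \<open>\<Theta>\<close>, and at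
  \<open>x = -1\<close> both \<open>f\<close> and \<open>\<Theta>(-x)\<close> vanish.\<close>

lemma pole_series_derivative_theta_quotient:
  "pole_series (sg q) 1 (- 1) * tri_sum q ^ 2 = - (alt_tri_sum q ^ 2)"
proof -
  obtain c where c: "\<And>x. x \<in> inner_annulus q \<Longrightarrow> pole_series (sg q) 0 x * \<Theta> x = c * \<Theta> (- x)"
    using pole_series_times_theta by blast
  let ?f = "pole_series (sg q)"
  define L where "L = laurent_sum (tail (sg q))"
  define L' where "L' = laurent_sum (\<lambda>n. of_int n * tail (sg q) n)"
  have inner_annulus: "norm q < norm x" "norm x < 1 / norm q" "norm q < norm (- x)" "norm (- x) < 1 / norm q" "x \<noteq> 1" "x \<noteq> 0"
    if "x \<in> inner_annulus q" for x
    using inner_annulus_imp[OF q that] by simp_all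
  have bd: "norm q < norm x" "norm x < 1 / norm q" if "norm x = 1" for x :: complex
    using that q by auto
  note dT = laurent_sum_derivative[OF q annular_theta_coeff]
  have dTm: "((\<lambda>x. \<Theta> (- x)) has_field_derivative \<Theta>' (- x) / x) (at x)" if "x \<in> inner_annulus q" for x
    by (rule DERIV_cong[OF DERIV_chain2[OF dT[OF inner_annulus(3,4)[OF that]] DERIV_minus[OF DERIV_ident]]]) (simp add: divide_inverse)
  note dL = laurent_sum_derivative[OF q annular_tail(1)[OF q], folded L_def L'_def]
  have cT: "isCont \<Theta> x" if "norm x = 1" for x
    using dT[OF bd[OF that]] by (rule DERIV_isCont)
  have cT': "isCont \<Theta>' x" if "norm x = 1" for x
    using laurent_sum_derivative[OF q annular_times_index[OF q(1) annular_theta_coeff] bd[OF that]] by (rule DERIV_isCont)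
  have cL: "isCont L x" if "norm x = 1" for x
    using dL[OF bd[OF that]] by (rule DERIV_isCont)
  have cL': "isCont L' x" if "norm x = 1" for x
    unfolding L'_def using laurent_sum_derivative[OF q annular_times_index[OF q(1) annular_tail(1)[OF q]] bd[OF that]] by (rule DERIV_isCont)
  have cTm: "isCont (\<lambda>x. \<Theta> (- x)) x" "isCont (\<lambda>x. \<Theta>' (- x)) x" if "norm x = 1" for x
    using isCont_o2[OF continuous_minus[OF continuous_ident] cT] isCont_o2[OF continuous_minus[OF continuous_ident] cT'] that
    by simp_all
  have vals: "\<Theta> 1 = 0" "\<Theta> (- 1) = tri_sum q" "\<Theta>' 1 = alt_tri_sum q"
  proof -
    show "\<Theta> 1 = 0" using infsum_theta_coeff by (simp add: laurent_sum_def)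
    have "theta_coeff n * (- 1) powi n = q powi tri n" for n
      by (simp add: theta_coeff_def mult_ac)
    then show "\<Theta> (- 1) = tri_sum q" by (simp add: laurent_sum_def tri_sum_def)
    show "\<Theta>' 1 = alt_tri_sum q" by (simp add: laurent_sum_def alt_tri_sum_def theta_coeff_def)
  qed
  have at_minus_one: "?f 1 (- 1) * tri_sum q = c * alt_tri_sum q"
  proof -
    have "?f 1 x * \<Theta> x + ?f 0 x * \<Theta>' x = c * \<Theta>' (- x)" if "x \<in> inner_annulus q" for x
      using c _ _ that
    proof (rule inner_annulus_derivative_unique[OF q])
      fix x assume x: "x \<in> inner_annulus q"
      have "(?f 0 has_field_derivative ?f 1 x / x) (at x)"
        using pole_series_derivatives(1)[OF q inner_annulus(1,2,5)[OF x], of 0] by simp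
      from DERIV_mult[OF this dT[OF inner_annulus(1,2)[OF x]]]
      show "((\<lambda>x. ?f 0 x * \<Theta> x) has_field_derivative (?f 1 x * \<Theta> x + ?f 0 x * \<Theta>' x) / x) (at x)"
        by (rule DERIV_cong) (simp add: add_divide_distrib mult.commute)
      show "((\<lambda>x. c * \<Theta> (- x)) has_field_derivative c * \<Theta>' (- x) / x) (at x)"
        by (rule DERIV_cong[OF DERIV_cmult[OF dTm[OF x]]]) simp
    qed
    then have "?f 1 (- 1) * \<Theta> (- 1) + ?f 0 (- 1) * \<Theta>' (- 1) = c * \<Theta>' (- (- 1))"
      by (rule inner_annulus_boundary_unique[OF q, where z = "- 1" and ?F1.0 = "\<lambda>x. ?f 1 x * \<Theta> x + ?f 0 x * \<Theta>' x"
            and ?F2.0 = "\<lambda>x. c * \<Theta>' (- x)"])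
         (assumption, simp, (intro continuous_intros isCont_pole_series(1)[OF q] cT cT' cTm; simp)+)
    then show ?thesis by (simp add: vals pole_series_zero_at_minus_one[OF q])
  qed
  have at_one: "alt_tri_sum q = - c * tri_sum q"
  proof -
    \<comment> \<open>Multiplication by \<open>1 - x\<close> removes the pole of f, so that the
      differentiated identity is continuous at 1.\<close>
    have c1: "(1 + (1 - x) * L x) * \<Theta> x = c * ((1 - x) * \<Theta> (- x))" if "x \<in> inner_annulus q" for x
    proof -
      have "?f 0 x = 1 / (1 - x) + L x" by (simp add: pole_series_def L_def)
      then have "(1 - x) * ?f 0 x = 1 + (1 - x) * L x"
        using inner_annulus(5)[OF that] by (simp add: distrib_left)
      then have "(1 + (1 - x) * L x) * \<Theta> x = (1 - x) * (?f 0 x * \<Theta> x)" by (simp add: mult.assoc[symmetric])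
      then show ?thesis unfolding c[OF that] by (simp only: mult.left_commute)
    qed
    have "((- x) * L x + (1 - x) * L' x) * \<Theta> x + (1 + (1 - x) * L x) * \<Theta>' x =
        c * (- x * \<Theta> (- x) + (1 - x) * \<Theta>' (- x))" if "x \<in> inner_annulus q" for x
      using c1 _ _ that
    proof (rule inner_annulus_derivative_unique[OF q])
      fix x assume x: "x \<in> inner_annulus q"
      have d1: "((\<lambda>x. 1 - x) has_field_derivative - 1) (at x)" by (auto intro!: derivative_eq_intros)
      have "((\<lambda>x. 1 + (1 - x) * L x) has_field_derivative 0 + (- 1 * L x + L' x / x * (1 - x))) (at x)"
        by (rule DERIV_add[OF DERIV_const DERIV_mult[OF d1 dL[OF inner_annulus(1,2)[OF x]]]])
      from DERIV_mult[OF this dT[OF inner_annulus(1,2)[OF x]]]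
      show "((\<lambda>x. (1 + (1 - x) * L x) * \<Theta> x) has_field_derivative
         (((- x) * L x + (1 - x) * L' x) * \<Theta> x + (1 + (1 - x) * L x) * \<Theta>' x) / x) (at x)"
        by (rule DERIV_cong) (use inner_annulus(6)[OF x] in \<open>simp add: field_simps\<close>)
      from DERIV_cmult[OF DERIV_mult[OF d1 dTm[OF x]], of c]
      show "((\<lambda>x. c * ((1 - x) * \<Theta> (- x))) has_field_derivative
         c * (- x * \<Theta> (- x) + (1 - x) * \<Theta>' (- x)) / x) (at x)"
        by (rule DERIV_cong) (use inner_annulus(6)[OF x] in \<open>simp add: field_simps\<close>)
    qed
    then have "((- 1) * L 1 + (1 - 1) * L' 1) * \<Theta> 1 + (1 + (1 - 1) * L 1) * \<Theta>' 1 =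
        c * (- 1 * \<Theta> (- 1) + (1 - 1) * \<Theta>' (- 1))"
      by (rule inner_annulus_boundary_unique[OF q, where z = 1 and
            ?F1.0 = "\<lambda>x. ((- x) * L x + (1 - x) * L' x) * \<Theta> x + (1 + (1 - x) * L x) * \<Theta>' x"
            and ?F2.0 = "\<lambda>x. c * (- x * \<Theta> (- x) + (1 - x) * \<Theta>' (- x))"])
         (assumption, simp, (intro continuous_intros cL cL' cT cT' cTm; simp)+)
    then show ?thesis by (simp add: vals)
  qed
  have "?f 1 (- 1) * tri_sum q ^ 2 = c * tri_sum q * alt_tri_sum q"
    using at_minus_one by (simp add: power2_eq_square mult_ac)
  then show ?thesis by (simp add: at_one power2_eq_square)
qed

text \<open>Jacobi's four-square theorem in Lambert form, at \<open>- q\<close>. Multiplied by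
  \<open>tri_sum q ^ 2\<close>, both sides become \<open>(2 * alt_tri_sum q) ^ 2\<close>, and the
  nonzero factor cancels.\<close>

lemma theta3_null_minus_power4: "theta3_null (- q) ^ 4 = 1 - 8 * U 1 q"
proof -
  have v: "pole_series (sg q) 1 (- 1) = - (1 - 8 * U 1 q) / 4"
    using odd_pole_series_at_minus_one(1)[OF q, of 1] by (simp add: pderiv_pCons field_simps)
  have "(1 - 8 * U 1 q) * tri_sum q ^ 2 = - 4 * (pole_series (sg q) 1 (- 1) * tri_sum q ^ 2)"
    unfolding v by (simp add: field_simps)
  also have "\<dots> = (2 * alt_tri_sum q) ^ 2"
    unfolding pole_series_derivative_theta_quotient by (simp add: power_mult_distrib)
  also have "\<dots> = theta3_null (- q) ^ 4 * tri_sum q ^ 2"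
    unfolding jacobi_derivative_formula[OF q] by (simp add: power_mult_distrib power2_eq_square power4_eq_xxxx)
  finally show ?thesis using tri_sum_nonzero[OF q] by simp
qed

text \<open>The left side is the fourth power of \<open>1 - 8 * U 1 q\<close>, which the determinant
  relation among the Lambert series evaluates.\<close>

lemma theta3_null_minus_power16:
  "theta3_null (- q) ^ 16 = 1 - 32 / 3 * (U 1 q + U 3 q + U 5 q) + 256 / 3 * (U 1 q * U 5 q - U 3 q ^ 2)"
proof -
  have "3 * theta3_null (- q) ^ 16 = 3 * (1 - 8 * U 1 q) ^ 4"
    unfolding theta3_null_minus_power4[symmetric] power_mult[symmetric] by simp
  also have "\<dots> = 4 * (1 - 8 * U 1 q) * (1 - 8 * U 5 q) - (1 + 16 * U 3 q) ^ 2"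
    by (rule lambert_series_relations(4)[OF q, symmetric])
  also have "\<dots> = 3 * (1 - 32 / 3 * (U 1 q + U 3 q + U 5 q) + 256 / 3 * (U 1 q * U 5 q - U 3 q ^ 2))"
    by (simp add: algebra_simps power2_eq_square)
  finally show ?thesis by (simp only: mult_cancel_left) simp
qed

lemma theta3_null_minus_power24:
  "theta3_null (- q) ^ 24 = 1 + 16 / 9 * (17 * G 3 q + 8 * G 5 q + 2 * G 7 q)
     + 512 / 9 * (G 3 q * G 7 q - G 5 q ^ 2)"
proof -
  define A B C where "A = 1 - 8 * U 1 q" and "B = 1 + 16 * U 3 q" and "C = 1 - 8 * U 5 q"
  note r = lambert_series_relations[OF q, folded A_def B_def C_def]
  have "9 * theta3_null (- q) ^ 24 = A ^ 2 * 3 * (3 * A ^ 4)"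
    unfolding A_def theta3_null_minus_power4[symmetric] power_mult[symmetric] by (simp flip: power_add)
  \<comment> \<open>Writing 3 (4 A C - B^2) as (12 A C + 5 B^2) - 8 B^2 isolates the combination
    that equals \<open>17 + 32 * G 7 q\<close>.\<close>
  also have "\<dots> = A ^ 2 * (12 * A * C + 5 * B ^ 2) - 8 * (A * B) ^ 2"
    unfolding r(4)[symmetric] by (simp add: algebra_simps power2_eq_square)
  also have "\<dots> = (1 + 16 * G 3 q) * (17 + 32 * G 7 q) - 8 * (1 - 8 * G 5 q) ^ 2"
    unfolding r ..
  also have "\<dots> = 9 * (1 + 16 / 9 * (17 * G 3 q + 8 * G 5 q + 2 * G 7 q)
     + 512 / 9 * (G 3 q * G 7 q - G 5 q ^ 2))"
    by (simp add: algebra_simps power2_eq_square)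
  finally show ?thesis by (simp only: mult_cancel_left) simp
qed

end

section \<open>Divisor-sum and double-series forms of the Lambert series\<close>

lemma norm_power_pos_less_one: "norm z < 1 \<Longrightarrow> 1 \<le> m \<Longrightarrow> norm (z ^ m) < 1" for z :: complex
  by (simp add: norm_power power_less_one_iff)

text \<open>For fixed \<open>m\<close> the norms are dominated by a geometric series in
  \<open>y\<close> with sum at most \<open>m ^ s * norm q ^ m / (1 - norm q)\<close>, which is
  summable over \<open>m\<close>.\<close>

lemma summable_lambert_pairs:
  fixes q :: complex
  assumes q: "norm q < 1" and c: "\<And>y m. norm (c y m) \<le> 1"
  shows "(\<lambda>(m :: nat, y :: nat). c y m * of_nat m ^ s * q ^ (m * y)) summable_on ({1..} \<times> {1..})"
proof -
  have pairs: "(\<lambda>p. real (fst p) ^ s * norm q ^ (fst p * snd p)) summable_on ({1..} \<times> {1 :: nat..})"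
  proof (rule summable_on_SigmaI)
    fix m :: nat assume "m \<in> {1..}"
    then have "norm (norm q ^ m) < 1" using norm_power_pos_less_one[OF q, of m] by (simp add: norm_power)
    from has_sum_cmult_right[OF has_sum_geometric_from_1[OF this], of "real m ^ s"]
    show "((\<lambda>y. real (fst (m, y)) ^ s * norm q ^ (fst (m, y) * snd (m, y))) has_sum
        real m ^ s * (norm q ^ m / (1 - norm q ^ m))) {1..}"
      by (simp add: power_mult)
  next
    have "summable (\<lambda>m. norm (of_nat m ^ s * q ^ m))" by (rule summable_power_weights[OF q])
    then have "(\<lambda>m. real m ^ s * norm q ^ m) summable_on UNIV"
      by (intro norm_summable_imp_summable_on) (simp add: norm_mult norm_power)
    then have "(\<lambda>m. real m ^ s * norm q ^ m) summable_on {1..}" by (rule summable_on_subset) simp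
    then have "(\<lambda>m. real m ^ s * norm q ^ m * (1 / (1 - norm q))) summable_on {1..}"
      by (rule summable_on_cmult_left)
    then show "(\<lambda>m. real m ^ s * (norm q ^ m / (1 - norm q ^ m))) summable_on {1..}"
    proof (rule summable_on_comparison_test)
      fix m :: nat assume m: "m \<in> {1..}"
      have p: "norm q ^ m \<le> norm q" using power_decreasing[of 1 m "norm q"] q m by simp
      have "norm q ^ m / (1 - norm q ^ m) \<le> norm q ^ m / (1 - norm q)"
        using p q by (intro divide_left_mono mult_pos_pos) auto
      then show "real m ^ s * (norm q ^ m / (1 - norm q ^ m)) \<le> real m ^ s * norm q ^ m * (1 / (1 - norm q))"
        using mult_left_mono[of _ _ "real m ^ s"] by fastforce
      show "0 \<le> real m ^ s * (norm q ^ m / (1 - norm q ^ m))" using p q by auto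
    qed
  qed auto
  show ?thesis
  proof (rule summable_on_complex_comparison[OF pairs])
    fix p :: "nat \<times> nat"
    have "norm (c (snd p) (fst p)) * (real (fst p) ^ s * norm q ^ (fst p * snd p)) \<le> 1 * (real (fst p) ^ s * norm q ^ (fst p * snd p))"
      by (intro mult_right_mono c) auto
    then show "norm (case p of (m, y) \<Rightarrow> c y m * of_nat m ^ s * q ^ (m * y)) \<le> real (fst p) ^ s * norm q ^ (fst p * snd p)"
      by (simp add: case_prod_unfold norm_mult norm_power mult_ac)
  qed
qed

text \<open>One absolutely convergent double series is summed along rows, over all pairs, and along
  the hyperbolas \<open>m * y = n\<close>. The sign pattern \<open>c y m\<close> is
  \<open>(- 1) ^ (y + m)\<close> for \<open>U\<close> and \<open>(- 1) ^ m\<close> for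
  \<open>G\<close>.\<close>

lemma lambert_series_rearrangements:
  fixes q :: complex
  assumes q: "norm q < 1" and c: "\<And>y m. norm (c y m) \<le> 1"
    and inner: "\<And>m. 1 \<le> m \<Longrightarrow> ((\<lambda>y. c y m * of_nat m ^ s * q ^ (m * y)) has_sum g m) {1..}"
  shows "(g has_sum infsum g {1..}) {1..}"
    and "((\<lambda>(y :: nat, m :: nat). c y m * of_nat m ^ s * q ^ (m * y)) has_sum infsum g {1..}) ({1..} \<times> {1..})"
    and "((\<lambda>n. (\<Sum>d\<in>{d. d dvd n \<and> 0 < d}. c (n div d) d * of_nat d ^ s) * q ^ n) has_sum infsum g {1..}) {1..}"
proof -
  define F where "F = (\<lambda>(m :: nat, y :: nat). c y m * of_nat m ^ s * q ^ (m * y))"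
  have "F summable_on ({1..} \<times> {1..})" unfolding F_def by (rule summable_lambert_pairs[OF q c])
  then obtain S where S: "(F has_sum S) ({1..} \<times> {1..})" by (auto simp: summable_on_def)
  have gS: "(g has_sum S) {1..}"
    by (rule has_sum_SigmaD[OF S]) (use inner in \<open>simp add: F_def\<close>)
  then have Sg: "S = infsum g {1..}" by (simp add: has_sum_iff)
  show "(g has_sum infsum g {1..}) {1..}" using gS Sg by simp
  have "((\<lambda>(y, m). F (m, y)) has_sum S) ({1..} \<times> {1..}) \<longleftrightarrow> (F has_sum S) ({1..} \<times> {1..})"
    by (rule has_sum_reindex_bij_witness[where i = "\<lambda>(m, y). (y, m)" and j = "\<lambda>(y, m). (m, y)"]) auto
  then show "((\<lambda>(y :: nat, m :: nat). c y m * of_nat m ^ s * q ^ (m * y)) has_sum infsum g {1..}) ({1..} \<times> {1..})"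
    using S Sg by (simp add: F_def)
  \<comment> \<open>A pair corresponds to \<open>n = m * y\<close> with the chosen divisor
    \<open>d = m\<close>; the other factor is \<open>n div d\<close>.\<close>
  have "(F has_sum S) ({1..} \<times> {1..}) \<longleftrightarrow>
      ((\<lambda>(n, d). c (n div d) d * of_nat d ^ s * q ^ n) has_sum S) (Sigma {1..} (\<lambda>n. {d. d dvd n \<and> 0 < d}))"
    by (rule has_sum_reindex_bij_witness[where i = "\<lambda>(n, d). (d, n div d)" and j = "\<lambda>(m, y). (m * y, m)"])
       (auto simp: F_def Suc_le_eq elim!: dvdE)
  then have "((\<lambda>(n, d). c (n div d) d * of_nat d ^ s * q ^ n) has_sum S) (Sigma {1..} (\<lambda>n. {d. d dvd n \<and> 0 < d}))"
    using S by simp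
  then have "((\<lambda>n. \<Sum>d\<in>{d. d dvd n \<and> 0 < d}. c (n div d) d * of_nat d ^ s * q ^ n) has_sum S) {1..}"
  proof (rule has_sum_SigmaD)
    fix n :: nat assume "n \<in> {1..}"
    then have "finite {d. d dvd n \<and> 0 < d}" by (auto intro: finite_subset[OF _ finite_divisors_nat])
    then show "((\<lambda>d. case (n, d) of (n, d) \<Rightarrow> c (n div d) d * of_nat d ^ s * q ^ n) has_sum
        (\<Sum>d\<in>{d. d dvd n \<and> 0 < d}. c (n div d) d * of_nat d ^ s * q ^ n)) {d. d dvd n \<and> 0 < d}"
      by (simp add: has_sum_finite)
  qed
  then show "((\<lambda>n. (\<Sum>d\<in>{d. d dvd n \<and> 0 < d}. c (n div d) d * of_nat d ^ s) * q ^ n) has_sum infsum g {1..}) {1..}"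
    using Sg by (simp add: sum_distrib_right)
qed

text \<open>The inner sum over \<open>y\<close> is geometric with ratio \<open>- (q ^ m)\<close>;
  the sign of its first term turns \<open>(- 1) ^ m\<close> into
  \<open>(- 1) ^ (m - 1)\<close>.\<close>

lemma U_rearrangements:
  fixes q :: complex
  assumes "norm q < 1"
  shows "((\<lambda>r::nat. (-1) ^ (r - 1) * (of_nat r ^ s * q ^ r / (1 + q ^ r))) has_sum U s q) {1..}"
    and "((\<lambda>n::nat. (\<Sum>d\<in>{d. d dvd n \<and> 0 < d}. (-1) ^ (d + n div d) * of_nat d ^ s) * q ^ n) has_sum U s q) {1..}"
    and "((\<lambda>(y::nat, m::nat). (-1) ^ (y + m) * of_nat m ^ s * q ^ (m * y)) has_sum U s q) ({1..} \<times> {1..})"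
proof -
  let ?g = "\<lambda>r::nat. (-1) ^ (r - 1) * (of_nat r ^ s * q ^ r / (1 + q ^ r))"
  have inner: "((\<lambda>y. (-1) ^ (y + m) * of_nat m ^ s * q ^ (m * y)) has_sum ?g m) {1..}" if m: "1 \<le> m" for m
  proof -
    have "norm (- (q ^ m)) < 1" using norm_power_pos_less_one[OF assms m] by simp
    from has_sum_cmult_right[OF has_sum_geometric_from_1[OF this], of "(- 1) ^ m * of_nat m ^ s"]
    have "((\<lambda>y. (- 1) ^ m * of_nat m ^ s * (- (q ^ m)) ^ y) has_sum (- 1) ^ m * of_nat m ^ s * (- (q ^ m) / (1 + q ^ m))) {1..}"
      by simp
    moreover have "(- (q ^ m)) ^ y = (- 1) ^ y * q ^ (m * y)" for y
      by (simp add: power_mult power_minus[of "q ^ m"])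
    moreover have "(- 1) ^ m * of_nat m ^ s * (- (q ^ m) / (1 + q ^ m)) = ?g m"
      using m by (cases m) auto
    ultimately show ?thesis by (simp add: power_add mult_ac)
  qed
  show "(?g has_sum U s q) {1..}"
    "((\<lambda>n::nat. (\<Sum>d\<in>{d. d dvd n \<and> 0 < d}. (-1) ^ (d + n div d) * of_nat d ^ s) * q ^ n) has_sum U s q) {1..}"
    "((\<lambda>(y::nat, m::nat). (-1) ^ (y + m) * of_nat m ^ s * q ^ (m * y)) has_sum U s q) ({1..} \<times> {1..})"
    using lambert_series_rearrangements[OF assms _ inner] unfolding U_def
    by (simp_all add: norm_power add.commute)
qed

lemma G_rearrangements:
  fixes q :: complex
  assumes "norm q < 1"
  shows "((\<lambda>r::nat. (-1) ^ r * (of_nat r ^ s * q ^ r / (1 - q ^ r))) has_sum G s q) {1..}"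
    and "((\<lambda>n::nat. (\<Sum>d\<in>{d. d dvd n \<and> 0 < d}. (-1) ^ d * of_nat d ^ s) * q ^ n) has_sum G s q) {1..}"
    and "((\<lambda>(y::nat, m::nat). (-1) ^ m * of_nat m ^ s * q ^ (m * y)) has_sum G s q) ({1..} \<times> {1..})"
proof -
  let ?g = "\<lambda>r::nat. (-1) ^ r * (of_nat r ^ s * q ^ r / (1 - q ^ r))"
  have inner: "((\<lambda>y. (-1) ^ m * of_nat m ^ s * q ^ (m * y)) has_sum ?g m) {1..}" if m: "1 \<le> m" for m
    using has_sum_cmult_right[OF has_sum_geometric_from_1[OF norm_power_pos_less_one[OF assms m]], of "(- 1) ^ m * of_nat m ^ s"]
    by (simp add: power_mult mult.assoc)
  show "(?g has_sum G s q) {1..}"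
    "((\<lambda>n::nat. (\<Sum>d\<in>{d. d dvd n \<and> 0 < d}. (-1) ^ d * of_nat d ^ s) * q ^ n) has_sum G s q) {1..}"
    "((\<lambda>(y::nat, m::nat). (-1) ^ m * of_nat m ^ s * q ^ (m * y)) has_sum G s q) ({1..} \<times> {1..})"
    using lambert_series_rearrangements[OF assms _ inner] unfolding G_def
    by (simp_all add: norm_power)
qed

theorem theorem1p5:
  fixes q :: complex
  assumes "0 < norm q" and "norm q < 1"
  shows "theta3_null (- q) ^ 16 =
           1 - 32 / 3 * (U 1 q + U 3 q + U 5 q) + 256 / 3 * (U 1 q * U 5 q - (U 3 q) ^ 2) \<and>
         theta3_null (- q) ^ 24 =
           1 + 16 / 9 * (17 * G 3 q + 8 * G 5 q + 2 * G 7 q)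
             + 512 / 9 * (G 3 q * G 7 q - (G 5 q) ^ 2) \<and>
         (\<forall>s :: nat.
             ((\<lambda>r::nat. (-1) ^ (r - 1) * (of_nat r ^ s * q ^ r / (1 + q ^ r))) has_sum U s q) {1..} \<and>
             ((\<lambda>n::nat. (\<Sum>d\<in>{d. d dvd n \<and> 0 < d}. (-1) ^ (d + n div d) * of_nat d ^ s) * q ^ n) has_sum U s q) {1..} \<and>
             ((\<lambda>(y::nat, m::nat). (-1) ^ (y + m) * of_nat m ^ s * q ^ (m * y)) has_sum U s q) ({1..} \<times> {1..})) \<and>
         (\<forall>s :: nat.
             ((\<lambda>r::nat. (-1) ^ r * (of_nat r ^ s * q ^ r / (1 - q ^ r))) has_sum G s q) {1..} \<and>
             ((\<lambda>n::nat. (\<Sum>d\<in>{d. d dvd n \<and> 0 < d}. (-1) ^ d * of_nat d ^ s) * q ^ n) has_sum G s q) {1..} \<and>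
             ((\<lambda>(y::nat, m::nat). (-1) ^ m * of_nat m ^ s * q ^ (m * y)) has_sum G s q) ({1..} \<times> {1..}))"
  by (intro conjI allI theta3_null_minus_power16[OF assms] theta3_null_minus_power24[OF assms]
      U_rearrangements[OF assms(2)] G_rearrangements[OF assms(2)])

end
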